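(* Let $q$ be a fixed prime power and let $n\ge 1$ vary. Let $\epsilon>0$ be such that the product of two $N\times N$ matrices over $\mathbb{F}_q$ can be computed with $O(N^{2+\epsilon})$ operations in $\mathbb{F}_q$ (for the best known matrix multiplication methods, $\epsilon\approx 0.38$). In the model S1, there exist algorithms for multiplication and for exponentiation in $\mathbb{F}_{q^n}$ (over $\mathbb{F}_q$) such that: (a) one product of two elements of $\mathbb{F}_{q^n}$ is computed in parallel time $O(1)$ multiplications in $\mathbb{F}_q$ using $O(n^2)$ processors, with a total of $O(n^2)$ multiplications; (b) in the amortized sense (when many products in $\mathbb{F}_{q^n}$ are computed simultaneously), each product is computed in parallel time $O(1)$ multiplications in $\mathbb{F}_q$ using $O(n^{1+\epsilon})$ processors, with a total of $O(n^{1+\epsilon})$ multiplications; (c) for $x\in\mathbb{F}_{q^n}$ and a positive integer exponent $k$, the power $x^k$ is computed in parallel time $O(\log n)$ multiplications in $\mathbb{F}_q$ using $O(n^{2+\epsilon}/\log^{2\epsilon} n)$ processors, with a total of $O(n^{2+\epsilon}\log^{1-2\epsilon} n)$ multiplications.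
   Context: Elements of $\mathbb{F}_{q^n}$ are represented by coordinate vectors over $\mathbb{F}_q$ in a fixed basis. In the model S1, all multiplications in $\mathbb{F}_q$ are counted, without distinguishing bilinear multiplications (of two input-dependent quantities) from scalar multiplications (by constants independent of the inputs); additions and subtractions in $\mathbb{F}_q$ are free. Algorithms are measured by parallel time (depth), number of processors (width) and total number of counted operations (size). "Amortized" means the cost per product when $\Omega(n)$ products in $\mathbb{F}_{q^n}$ are performed together. *)

theory Defs
  imports Complex_Main "HOL-Computational_Algebra.Computational_Algebra"
begin

text \<open>Instruction k of a program may refer to inputs and to results of earlier
instructions j < k. Additions/subtractions are free; every multiplication
(bilinear Mul or scalar SMul by a constant) is counted.\<close>

datatype 'a instr = Inp nat | Cst 'a | Add nat nat | Sub nat nat | Mul nat nat | SMul 'a nat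

fun ieval :: "'a::comm_ring_1 list \<Rightarrow> 'a list \<Rightarrow> 'a instr \<Rightarrow> 'a" where
  "ieval xs vs (Inp i) = xs ! i"
| "ieval xs vs (Cst c) = c"
| "ieval xs vs (Add i j) = vs ! i + vs ! j"
| "ieval xs vs (Sub i j) = vs ! i - vs ! j"
| "ieval xs vs (Mul i j) = vs ! i * vs ! j"
| "ieval xs vs (SMul c i) = c * vs ! i"

definition run :: "'a::comm_ring_1 list \<Rightarrow> 'a instr list \<Rightarrow> 'a list" where
  "run xs P = foldl (\<lambda>vs ins. vs @ [ieval xs vs ins]) [] P"

fun args :: "'a instr \<Rightarrow> nat list" where
  "args (Inp i) = []"
| "args (Cst c) = []"
| "args (Add i j) = [i, j]"
| "args (Sub i j) = [i, j]"
| "args (Mul i j) = [i, j]"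
| "args (SMul c i) = [i]"

fun is_mult :: "'a instr \<Rightarrow> bool" where
  "is_mult (Mul i j) = True"
| "is_mult (SMul c i) = True"
| "is_mult _ = False"

definition wf_prog :: "nat \<Rightarrow> 'a instr list \<Rightarrow> bool" where
  "wf_prog I P = (\<forall>k < length P. (\<forall>j \<in> set (args (P ! k)). j < k) \<and>
                                  (\<forall>i. P ! k = Inp i \<longrightarrow> i < I))"

fun idepth :: "nat list \<Rightarrow> 'a instr \<Rightarrow> nat" where
  "idepth ds (Inp i) = 0"
| "idepth ds (Cst c) = 0"
| "idepth ds (Add i j) = max (ds ! i) (ds ! j)"
| "idepth ds (Sub i j) = max (ds ! i) (ds ! j)"
| "idepth ds (Mul i j) = Suc (max (ds ! i) (ds ! j))"
| "idepth ds (SMul c i) = Suc (ds ! i)"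

definition depths :: "'a instr list \<Rightarrow> nat list" where
  "depths P = foldl (\<lambda>ds ins. ds @ [idepth ds ins]) [] P"

text \<open>depth (parallel time), size (total number of multiplications),
 width (number of processors = max number of multiplications in one parallel step).\<close>
definition mdepth :: "'a instr list \<Rightarrow> nat" where
  "mdepth P = Max (insert 0 (set (depths P)))"

definition msize :: "'a instr list \<Rightarrow> nat" where
  "msize P = length (filter is_mult P)"

definition mwidth :: "'a instr list \<Rightarrow> nat" where
  "mwidth P = Max ((\<lambda>d. card {k. k < length P \<and> is_mult (P ! k) \<and> depths P ! k = d}) ` {0..mdepth P})"

definition computes :: "nat \<Rightarrow> 'a::comm_ring_1 instr list \<Rightarrow> nat list \<Rightarrow> ('a list \<Rightarrow> 'a list) \<Rightarrow> bool" where
  "computes I P outs F = (wf_prog I P \<and> (\<forall>r \<in> set outs. r < length P) \<and>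
     (\<forall>xs. length xs = I \<longrightarrow> map (\<lambda>r. run xs P ! r) outs = F xs))"

definition matmul :: "nat \<Rightarrow> 'a::comm_ring_1 list \<Rightarrow> 'a list" where
  "matmul N xs = [(\<Sum>l<N. xs ! (i * N + l) * xs ! (N * N + l * N + j)). i \<leftarrow> [0..<N], j \<leftarrow> [0..<N]]"

text \<open>F_{q^n} realised as F_q[x]/(f), f irreducible of degree n, with an arbitrary
F_q-basis beta_0..beta_{n-1} (residues of degree < n).\<close>
definition ext_basis :: "'a::field poly \<Rightarrow> (nat \<Rightarrow> 'a poly) \<Rightarrow> nat \<Rightarrow> bool" where
  "ext_basis f \<beta> n = (irreducible f \<and> degree f = n \<and> (\<forall>i<n. degree (\<beta> i) < n) \<and>
     (\<forall>c. (\<Sum>i<n. smult (c i) (\<beta> i)) = 0 \<longrightarrow> (\<forall>i<n. c i = 0)))"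

definition elem :: "(nat \<Rightarrow> 'a::field poly) \<Rightarrow> nat \<Rightarrow> 'a list \<Rightarrow> 'a poly" where
  "elem \<beta> n c = (\<Sum>i<n. smult (c ! i) (\<beta> i))"

definition coords :: "(nat \<Rightarrow> 'a::field poly) \<Rightarrow> nat \<Rightarrow> 'a poly \<Rightarrow> 'a list" where
  "coords \<beta> n p = (THE c. length c = n \<and> elem \<beta> n c = p)"

definition fmul :: "'a::field poly \<Rightarrow> (nat \<Rightarrow> 'a poly) \<Rightarrow> nat \<Rightarrow> 'a list \<Rightarrow> 'a list" where
  "fmul f \<beta> n xs = coords \<beta> n ((elem \<beta> n (take n xs) * elem \<beta> n (drop n xs)) mod f)"

definition fmul_many :: "'a::field poly \<Rightarrow> (nat \<Rightarrow> 'a poly) \<Rightarrow> nat \<Rightarrow> nat \<Rightarrow> 'a list \<Rightarrow> 'a list" where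
  "fmul_many f \<beta> n m xs = concat (map (\<lambda>t. fmul f \<beta> n (take (2 * n) (drop (2 * n * t) xs))) [0..<m])"

definition fpow :: "'a::field poly \<Rightarrow> (nat \<Rightarrow> 'a poly) \<Rightarrow> nat \<Rightarrow> nat \<Rightarrow> 'a list \<Rightarrow> 'a list" where
  "fpow f \<beta> n k xs = coords \<beta> n ((elem \<beta> n xs ^ k) mod f)"

end

theory Submission
  imports Defs "HOL-Real_Asymp.Real_Asymp"
begin

text \<open>
  Additions are free and the base field is fixed, so any linear map applied to \<open>n\<close> coordinates costs
  only \<open>q * n\<close> multiplications in one parallel step: form all scalar multiples, then add. Hence a
  bilinear formula of rank \<open>R\<close> for the product is a circuit of depth \<open>3\<close> and size \<open>O(n + R)\<close>.

  The rank is quasilinear. Let \<open>Q\<close> be a power of the characteristic with \<open>c^Q = c\<close> on the base field,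
  and let \<open>h = X^(Q^m) - X\<close> have degree between \<open>2 * n\<close> and \<open>2 * n * Q\<close>. It is squarefree and its
  irreducible factors have degree \<open>O(log n)\<close>, so the Chinese remainder theorem with schoolbook
  multiplication modulo each factor has rank \<open>O(n * log n)\<close>. This is better than \<open>n^(1 + \<epsilon>)\<close>.

  For powers, Fermat reduces the exponent below \<open>q^n\<close>, and base-\<open>Q\<close> digits turn \<open>x^k\<close> into a product of
  \<open>O(n)\<close> factors \<open>x^(Q^e)\<close>, which are linear in \<open>x\<close>. A binary tree multiplies them in depth
  \<open>O(log n)\<close>.
\<close>

section \<open>Bilinear multiplication modulo a separable polynomial\<close>

text \<open>Root counting over the domain R/p, done in R without forming the quotient: after
  division by X - s, primality of \<open>p\<close> makes every other root modulo \<open>p\<close> a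
  root of the quotient polynomial. The condition on the leading coefficient says that the degree
  does not drop modulo \<open>p\<close>.\<close>

lemma card_roots_mod_le:
  fixes h :: "'a::idom poly"
  assumes "prime_elem p" and "\<not> p dvd lead_coeff h" and "finite S"
    and "\<And>s. s \<in> S \<Longrightarrow> p dvd poly h s"
    and "\<And>s t. s \<in> S \<Longrightarrow> t \<in> S \<Longrightarrow> p dvd s - t \<Longrightarrow> s = t"
  shows "card S \<le> degree h"
  using assms(2-)
proof (induction "degree h" arbitrary: h S)
  case 0
  then obtain c where h: "h = [:c:]"
    by (metis degree_eq_zeroE)
  \<comment> \<open>A constant \<open>h\<close> takes its leading coefficient as value everywhere,
    so it has no root modulo \<open>p\<close>.\<close>
  have "S = {}"
    using 0 h by auto
  then show ?case by simp
next
  case (Suc d)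
  show ?case
  proof (cases "S = {}")
    case False
    then obtain s where s: "s \<in> S" by blast
    define h1 where "h1 = synthetic_div h s"
    have dh1: "degree h1 = d"
      using Suc.hyps(2) by (simp add: h1_def degree_synthetic_div)
    have h: "[:-s, 1:] * h1 + [:poly h s:] = h"
      unfolding h1_def by (rule synthetic_div_correct')
    have "coeff h (Suc d) = coeff h1 d"
      using dh1 by (subst h[symmetric]) (simp add: coeff_eq_0)
    then have lc: "lead_coeff h1 = lead_coeff h"
      using dh1 Suc.hyps(2) by simp
    have "card (S - {s}) \<le> degree h1"
    proof (rule Suc.hyps(1))
      fix g assume g: "g \<in> S - {s}"
      have "poly h g = (g - s) * poly h1 g + poly h s"
        by (subst h[symmetric]) (simp add: algebra_simps)
      then have "p dvd (g - s) * poly h1 g"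
        using Suc.prems(3)[of g] Suc.prems(3)[of s] g s
        by (metis DiffD1 dvd_add_left_iff)
      moreover have "\<not> p dvd g - s"
        using Suc.prems(4)[of g s] g s by auto
      ultimately show "p dvd poly h1 g"
        using assms(1) prime_elem_dvd_multD by blast
    qed (use dh1 lc Suc.prems in auto)
    then show ?thesis
      using s Suc.prems(2) dh1 Suc.hyps(2) by (simp add: card_Diff_singleton)
  qed auto
qed

section \<open>Counting polynomials of bounded degree\<close>

lemma polys_degree_less_eq_image:
  "{p :: 'a::zero poly. p = 0 \<or> degree p < n} = Poly ` {xs. length xs = n}"
proof safe
  fix p :: "'a poly" assume "degree p < n"
  then have "length (coeffs p) \<le> n" by (cases "p = 0") (auto simp: length_coeffs_degree)
  then show "p \<in> Poly ` {xs. length xs = n}"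
    by (intro image_eqI[of _ _ "coeffs p @ replicate (n - length (coeffs p)) 0"]) auto
next
  show "0 \<in> Poly ` {xs :: 'a list. length xs = n}"
    by (intro image_eqI[of _ _ "replicate n 0"]) auto
next
  fix xs :: "'a list" assume "\<not> degree (Poly xs) < length xs"
  moreover have "length (coeffs (Poly xs)) \<le> length xs"
    by (metis coeffs_Poly length_strip_while_le)
  ultimately show "Poly xs = 0"
    using length_coeffs_degree[of "Poly xs"] by force
qed

text \<open>Coefficient lists of fixed length \<open>n\<close>, padded with zeros, parametrise these
  polynomials. The explicit case \<open>p = 0\<close> makes the count right for \<open>n = 0\<close>
  too.\<close>

lemma
  shows finite_polys_degree_less: "finite {p :: 'a::{finite,zero} poly. p = 0 \<or> degree p < n}"
    and card_polys_degree_less: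
      "card {p :: 'a poly. p = 0 \<or> degree p < n} = card (UNIV :: 'a set) ^ n"
proof -
  have fin: "finite {xs :: 'a list. length xs = n}"
    using finite_lists_length_eq[of "UNIV :: 'a set" n] by simp
  then show "finite {p :: 'a poly. p = 0 \<or> degree p < n}"
    by (simp add: polys_degree_less_eq_image)
  have "inj_on (Poly :: 'a list \<Rightarrow> _) {xs. length xs = n}"
  proof (rule inj_onI)
    fix xs ys :: "'a list"
    assume "xs \<in> {xs. length xs = n}" "ys \<in> {xs. length xs = n}" and eq: "Poly xs = Poly ys"
    then have len: "length xs = n" "length ys = n" by auto
    show "xs = ys"
    proof (rule nth_equalityI)
      fix i assume "i < length xs"
      then show "xs ! i = ys ! i"
        using arg_cong[OF eq, of "\<lambda>p. coeff p i"] len by (simp add: nth_default_def)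
    qed (simp add: len)
  qed
  then show "card {p :: 'a poly. p = 0 \<or> degree p < n} = card (UNIV :: 'a set) ^ n"
    using card_lists_length_eq[of "UNIV :: 'a set" n]
    by (simp add: polys_degree_less_eq_image card_image)
qed

section \<open>The Frobenius map on the base field\<close>

lemma prime_CHAR_finite_field: "prime CHAR('a::{finite,field})"
  by (intro prime_CHAR_semidom finite_imp_CHAR_pos) simp

text \<open>Pigeonhole: a finite type has finitely many self-maps, so two iterates of Frobenius
  coincide, and injectivity cancels the smaller one. The resulting power map is additive and fixes
  all constants, hence is linear over the base field.\<close>

lemma ex_frobenius_exponent:
  "\<exists>j>0. \<forall>c::'a::{finite,field}. c ^ (CHAR('a) ^ j) = c"
proof -
  let ?p = "CHAR('a)"
  define F :: "nat \<Rightarrow> 'a \<Rightarrow> 'a" where "F = (\<lambda>j c. c ^ (?p ^ j))"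
  have p: "prime ?p" by (rule prime_CHAR_finite_field)
  have inj: "inj (F i)" for i
  proof (rule injI)
    fix c d assume "F i c = F i d"
    then have "(c - d) ^ (?p ^ i) + d ^ (?p ^ i) = d ^ (?p ^ i)"
      using freshmans_dream'[OF p refl, of "c - d" d i] by (simp add: F_def)
    then show "c = d" by simp
  qed
  have "\<not> inj F"
    using finite_imageD[of F UNIV] by (auto simp: finite_subset[OF subset_UNIV])
  then obtain i j where "F i = F j" "i \<noteq> j"
    by (auto simp: inj_def)
  then obtain i j where ij: "F i = F j" "i < j"
    by (metis linorder_neqE_nat)
  have "c ^ (?p ^ (j - i)) = c" for c :: 'a
  proof -
    have "F i (F (j - i) c) = F j c"
      using ij(2) by (simp add: F_def flip: power_mult power_add)
    then have "F i (F (j - i) c) = F i c" using ij(1) by simp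
    then show ?thesis using inj[of i] by (auto simp: F_def dest: injD)
  qed
  then show ?thesis using ij(2) by (intro exI[of _ "j - i"]) auto
qed

section \<open>Bilinear formulas and Chinese remaindering\<close>

definition linear_form :: "('a::field poly \<Rightarrow> 'a) \<Rightarrow> bool" where
  "linear_form a \<longleftrightarrow> (\<forall>x y. a (x + y) = a x + a y) \<and> (\<forall>c x. a (smult c x) = c * a x)"

text \<open>A triple \<open>(a, b, c)\<close> stands for one product of two input-dependent
  quantities, followed by scaling a fixed output \<open>c\<close>; the length of the list is the
  bilinear rank.\<close>

definition bilin_sum ::
  "(('a::field poly \<Rightarrow> 'a) \<times> ('a poly \<Rightarrow> 'a) \<times> 'a poly) list \<Rightarrow> 'a poly \<Rightarrow> 'a poly \<Rightarrow> 'a poly" where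
  "bilin_sum ts x y = (\<Sum>(a, b, c)\<leftarrow>ts. smult (a x * b y) c)"

text \<open>Only a congruence modulo \<open>g\<close> is required, so that formulas for different
  moduli can be recombined just by multiplying their outputs.\<close>

definition bilin_mult_mod ::
  "'a::field poly \<Rightarrow> (('a poly \<Rightarrow> 'a) \<times> ('a poly \<Rightarrow> 'a) \<times> 'a poly) list \<Rightarrow> bool" where
  "bilin_mult_mod g ts \<longleftrightarrow> (\<forall>(a, b, c)\<in>set ts. linear_form a \<and> linear_form b) \<and>
     (\<forall>x y. g dvd x * y - bilin_sum ts x y)"

lemma bilin_sum_append: "bilin_sum (ts @ us) x y = bilin_sum ts x y + bilin_sum us x y"
  by (simp add: bilin_sum_def)

lemma bilin_sum_concat: "bilin_sum (concat tss) x y = (\<Sum>ts\<leftarrow>tss. bilin_sum ts x y)"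
  by (induction tss) (simp_all add: bilin_sum_append, simp add: bilin_sum_def)

lemma linear_form_coeff_mod: "linear_form (\<lambda>x. coeff (x mod g) i)"
  by (simp add: linear_form_def poly_mod_add_left mod_smult_left)

lemma poly_eq_sum_monom:
  assumes "x = 0 \<or> degree x < n"
  shows "x = (\<Sum>i<n. monom (coeff x i) i)"
  using assms by (auto simp: poly_eq_iff coeff_sum coeff_eq_0 not_less)

text \<open>Schoolbook multiplication of the two residues: one term for each pair of
  coefficients.\<close>

lemma ex_bilin_mult_mod_square:
  fixes g :: "'a::field poly"
  assumes "g \<noteq> 0"
  shows "\<exists>ts. bilin_mult_mod g ts \<and> length ts = degree g * degree g"
proof -
  let ?e = "degree g"
  define ts where "ts = concat (map (\<lambda>i. map (\<lambda>j.
    (\<lambda>x. coeff (x mod g) i, \<lambda>y. coeff (y mod g) j, monom (1::'a) (i + j))) [0..<?e]) [0..<?e])"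
  have len: "length ts = ?e * ?e"
    by (simp add: ts_def length_concat comp_def sum_list_triv)
  have sum: "bilin_sum ts x y = (x mod g) * (y mod g)" for x y
  proof -
    have red: "z mod g = (\<Sum>i<?e. monom (coeff (z mod g) i) i)" for z
      using degree_mod_less[OF assms, of z] by (intro poly_eq_sum_monom) auto
    have "bilin_sum ts x y =
        (\<Sum>i<?e. \<Sum>j<?e. monom (coeff (x mod g) i) i * monom (coeff (y mod g) j) j)"
      by (simp add: ts_def bilin_sum_concat bilin_sum_def[of "map _ _"] comp_def mult_monom smult_monom
          interv_sum_list_conv_sum_set_nat atLeast0LessThan)
    also have "\<dots> = (x mod g) * (y mod g)"
      by (subst (3 4) red) (simp only: sum_product)
    finally show ?thesis .
  qed
  have "g dvd x * y - bilin_sum ts x y" for x y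
    unfolding sum by (metis mod_eq_dvd_iff mod_mult_eq)
  then have "bilin_mult_mod g ts"
    by (auto simp: bilin_mult_mod_def ts_def linear_form_coeff_mod)
  with len show ?thesis by blast
qed

lemma bilin_sum_scale:
  "bilin_sum (map (\<lambda>(a, b, c). (a, b, c * e)) ts) x y = bilin_sum ts x y * e"
  by (induction ts) (auto simp: bilin_sum_def algebra_simps)

text \<open>Chinese remaindering: \<open>t * v\<close> is 1 modulo \<open>u\<close> and 0 modulo
  \<open>v\<close>, and \<open>s * u\<close> the other way round. Weighting the outputs with these
  idempotents glues the two formulas, and the ranks add.\<close>

lemma bilin_mult_mod_coprime_mult:
  fixes u v :: "'a::field poly"
  assumes "s * u + t * v = 1" "bilin_mult_mod u us" "bilin_mult_mod v vs"
  shows "\<exists>ts. bilin_mult_mod (u * v) ts \<and> length ts = length us + length vs"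
proof -
  define ts where "ts = map (\<lambda>(a, b, c). (a, b, c * (t * v))) us @ map (\<lambda>(a, b, c). (a, b, c * (s * u))) vs"
  have "u * v dvd x * y - bilin_sum ts x y" for x y
  proof -
    have "x * y - bilin_sum ts x y =
        x * y * (s * u + t * v) - (bilin_sum us x y * (t * v) + bilin_sum vs x y * (s * u))"
      by (simp only: ts_def bilin_sum_append bilin_sum_scale assms(1) mult_1_right)
    also have "\<dots> = (x * y - bilin_sum us x y) * v * t + u * (x * y - bilin_sum vs x y) * s"
      by (simp add: algebra_simps)
    finally show ?thesis
      using assms(2,3) by (simp add: bilin_mult_mod_def dvd_mult2 mult_dvd_mono dvd_add)
  qed
  moreover have "\<forall>(a, b, c)\<in>set ts. linear_form a \<and> linear_form b"
    using assms(2,3) by (auto simp: bilin_mult_mod_def ts_def)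
  ultimately show ?thesis
    by (intro exI[of _ ts]) (simp add: bilin_mult_mod_def ts_def)
qed

text \<open>
  For \<open>h = u * v * w\<close> with \<open>h' = - 1\<close>, the Leibniz rule is a Bezout identity between \<open>u\<close> and \<open>v\<close>.
\<close>
lemma ex_bilin_mult_mod_separable:
  fixes h :: "'a::field poly"
  assumes "pderiv h = - 1" and "\<And>p. irreducible p \<Longrightarrow> p dvd h \<Longrightarrow> degree p \<le> D"
    and "g dvd h"
  shows "\<exists>ts. bilin_mult_mod g ts \<and> length ts \<le> degree g * D"
  using assms(3)
proof (induction "degree g" arbitrary: g rule: less_induct)
  case less
  have "h \<noteq> 0" using assms(1) by auto
  then have g0: "g \<noteq> 0" using less.prems by auto
  \<comment> \<open>A unit needs no terms, an irreducible factor uses the schoolbook formula of rank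
    at most \<open>degree g * D\<close>, and a proper factorisation adds ranks just as it adds
    degrees.\<close>
  consider (unit) "is_unit g" | (irreducible) "irreducible g"
    | (prod) u v where "g = u * v" "\<not> is_unit u" "\<not> is_unit v"
    using g0 by (auto simp: irreducible_def)
  then show ?case
  proof cases
    case unit
    then show ?thesis
      by (intro exI[of _ "[]"]) (simp add: bilin_mult_mod_def unit_imp_dvd)
  next
    case irreducible
    then have "degree g \<le> D" using assms(2) less.prems by blast
    then show ?thesis
      using ex_bilin_mult_mod_square[OF g0] by (metis mult_le_mono2)
  next
    case prod
    have uv0: "u \<noteq> 0" "v \<noteq> 0" using g0 prod by auto
    have deg: "degree g = degree u + degree v"
      using uv0 prod by (simp add: degree_mult_eq)
    have "degree u > 0" "degree v > 0"
      using prod(2,3) uv0 by (auto simp: is_unit_iff_degree)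
    then obtain us vs
      where us: "bilin_mult_mod u us" "length us \<le> degree u * D"
        and vs: "bilin_mult_mod v vs" "length vs \<le> degree v * D"
      using less.hyps[of u] less.hyps[of v] deg less.prems prod(1)
      by (metis add_lessD1 dvd_mult_left dvd_mult_right less_add_same_cancel1 less_add_same_cancel2)
    obtain w where w: "h = u * v * w"
      using less.prems prod(1) by auto
    have "- (v * pderiv w + w * pderiv v) * u + (- (w * pderiv u)) * v = - pderiv h"
      by (simp add: w pderiv_mult algebra_simps)
    also have "\<dots> = 1" using assms(1) by simp
    finally obtain ts where "bilin_mult_mod g ts" "length ts = length us + length vs"
      using bilin_mult_mod_coprime_mult us(1) vs(1) prod(1) by blast
    then show ?thesis
      using us(2) vs(2) deg by (auto simp: add_mult_distrib)
  qed
qed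

section \<open>Quasilinear rank of polynomial multiplication\<close>

text \<open>Raising to the power \<open>Q ^ m\<close> is additive in this characteristic and fixes
  scalars. This linearity serves both for bounding degrees of factors of X^N - X and for making
  Frobenius powers cheap in exponentiation.\<close>

lemma frobenius_power_smult_sum:
  fixes b :: "'i \<Rightarrow> 'a::{finite,field} poly"
  assumes "\<forall>c::'a. c ^ Q = c" and "Q = CHAR('a) ^ j"
  shows "(\<Sum>i\<in>A. smult (c i) (b i)) ^ (Q ^ m) = (\<Sum>i\<in>A. smult (c i) (b i ^ (Q ^ m)))"
proof -
  have c: "x ^ (Q ^ m) = x" for x :: 'a
    using assms(1) by (induction m) (simp_all add: power_mult)
  have "(\<Sum>i\<in>A. smult (c i) (b i)) ^ (Q ^ m) = (\<Sum>i\<in>A. (smult (c i) (b i)) ^ (Q ^ m))"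
    by (rule freshmans_dream_sum'[where n = "j * m"])
       (simp_all add: prime_CHAR_finite_field assms(2) power_mult)
  then show ?thesis
    by (simp add: smult_power c)
qed

text \<open>With N = \<open>Q ^ m\<close>, if X^N is congruent to X modulo \<open>p\<close>, then
  every residue modulo \<open>p\<close> is fixed by the N-th power map. All these residues are
  therefore roots of Y^N - Y modulo \<open>p\<close>, and there are at most N of them.\<close>

lemma degree_irreducible_dvd_frobenius_poly:
  fixes p :: "'a::{finite,field} poly"
  assumes "\<forall>c::'a. c ^ Q = c" and "Q = CHAR('a) ^ j" and "Q ^ m > 1"
    and "irreducible p" and "p dvd monom 1 (Q ^ m) - monom 1 1"
  shows "card (UNIV :: 'a set) ^ degree p \<le> Q ^ m"
proof -
  let ?N = "Q ^ m"
  have p: "prime_elem p" using assms(4) by (rule field_poly_irreducible_imp_prime)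
  then have "p \<noteq> 0" "\<not> is_unit p" by auto
  have X: "p dvd (monom 1 ?N) ^ i - monom 1 1 ^ i" for i
    using assms(5) by (metis dvd_mult2 power_diff_sumr2)
  \<comment> \<open>By linearity the N-th power of g(X) is g(X^N), which is congruent to
    g(X).\<close>
  have pow: "p dvd g ^ ?N - g" for g
  proof -
    let ?d = "Suc (degree g)"
    have g: "g = (\<Sum>i<?d. smult (coeff g i) (monom 1 1 ^ i))"
      by (subst poly_eq_sum_monom[of g ?d]) (auto simp: smult_monom monom_power)
    have "g ^ ?N = (\<Sum>i<?d. smult (coeff g i) ((monom 1 1 ^ i) ^ ?N))"
      by (subst g, rule frobenius_power_smult_sum[OF assms(1,2)])
    also have "\<dots> - g = (\<Sum>i<?d. smult (coeff g i) ((monom 1 ?N) ^ i - monom 1 1 ^ i))"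
      by (subst (2) g) (simp add: smult_diff_right sum_subtractf monom_power mult.commute
          del: sum.lessThan_Suc)
    also have "p dvd \<dots>"
      by (intro dvd_sum dvd_smult X)
    finally show ?thesis .
  qed
  \<comment> \<open>This is Y^N - Y in a second variable, to be evaluated at polynomials in
    X.\<close>
  define h :: "'a poly poly" where "h = monom 1 ?N - monom 1 1"
  have "degree h = ?N"
    using assms(3) unfolding h_def diff_conv_add_uminus
    by (subst degree_add_eq_left) (simp_all add: degree_monom_eq)
  moreover have "card {g :: 'a poly. g = 0 \<or> degree g < degree p} \<le> degree h"
  proof (rule card_roots_mod_le[OF p])
    have "lead_coeff h = 1"
      unfolding \<open>degree h = ?N\<close> using assms(3) by (simp add: h_def)
    then show "\<not> p dvd lead_coeff h"
      using \<open>\<not> is_unit p\<close> by simp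
    show "p dvd poly h g" for g
      using pow[of g] by (simp add: h_def poly_monom)
    fix s t assume st: "s \<in> {g. g = 0 \<or> degree g < degree p}"
      "t \<in> {g. g = 0 \<or> degree g < degree p}" "p dvd s - t"
    show "s = t"
    proof (rule ccontr)
      assume "s \<noteq> t"
      then have "degree p \<le> degree (s - t)"
        using st(3) by (intro dvd_imp_degree_le) auto
      moreover have "s - t = 0 \<or> degree (s - t) < degree p"
        using st(1,2) by (auto intro: degree_diff_less)
      ultimately show False using \<open>s \<noteq> t\<close> by simp
    qed
  qed (rule finite_polys_degree_less)
  ultimately show ?thesis
    by (simp add: card_polys_degree_less)
qed

lemma bilin_sum_mod: "bilin_sum (map (\<lambda>(a, b, c). (a, b, c mod g)) ts) x y = bilin_sum ts x y mod g"
  by (induction ts) (auto simp: bilin_sum_def poly_mod_add_left mod_smult_left)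

text \<open>The modulus X^(\<open>Q ^ m\<close>) - X has degree above that of the product, so the
  residue determines the product exactly; its rank is at most its degree times the logarithmic bound
  on the degrees of its irreducible factors.\<close>

lemma ex_bilin_mult_quasilinear:
  fixes fq :: "'a::{finite,field} itself"
  assumes "\<forall>c::'a. c ^ Q = c" and "Q = CHAR('a) ^ j" and "j > 0" and "n > 0"
  obtains ts :: "(('a poly \<Rightarrow> 'a) \<times> ('a poly \<Rightarrow> 'a) \<times> 'a poly) list" where
    "\<forall>(a, b, c)\<in>set ts. linear_form a \<and> linear_form b"
    "\<And>x y. degree x < n \<Longrightarrow> degree y < n \<Longrightarrow> x * y = bilin_sum ts x y"
    "real (length ts) \<le> 2 * real n * real Q * log 2 (2 * real n * real Q)"
proof -
  have Q: "Q > 1"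
    using prime_gt_1_nat[OF prime_CHAR_finite_field[where 'a = 'a]] assms(2,3)
    by (metis one_less_power)
  \<comment> \<open>Minimality of \<open>m\<close> gives \<open>Q ^ (m - 1) < 2 * n\<close>, so the
    modulus overshoots the needed degree by at most the constant factor \<open>Q\<close>.\<close>
  define m where "m = (LEAST m. 2 * n \<le> Q ^ m)"
  have "2 * n \<le> Q ^ (2 * n)"
    using less_exp[of "2 * n"] power_mono[of 2 Q "2 * n"] Q by linarith
  then have m: "2 * n \<le> Q ^ m"
    unfolding m_def by (rule LeastI)
  have "m \<noteq> 0" using m assms(4) by (cases m) auto
  have "Q ^ (m - 1) < 2 * n"
    using not_less_Least[of "m - 1" "\<lambda>m. 2 * n \<le> Q ^ m"] \<open>m \<noteq> 0\<close> by (simp add: m_def)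
  then have "Q * Q ^ (m - 1) \<le> Q * (2 * n)"
    by (intro mult_le_mono) auto
  then have N_le: "Q ^ m \<le> 2 * n * Q"
    using \<open>m \<noteq> 0\<close> by (metis mult.commute power_eq_if)
  let ?N = "Q ^ m"
  have N1: "?N > 1" using m assms(4) by linarith
  define h :: "'a poly" where "h = monom 1 ?N - monom 1 1"
  have "degree h = ?N"
    using N1 unfolding h_def diff_conv_add_uminus
    by (subst degree_add_eq_left) (simp_all add: degree_monom_eq)
  \<comment> \<open>The leading term of \<open>h\<close> thus has derivative zero, which leaves
    \<open>pderiv h = - 1\<close>.\<close>
  have "CHAR('a) dvd ?N"
    using \<open>m \<noteq> 0\<close> assms(2,3) by (metis dvd_power dvd_power_le dvd_refl gr0I dvd_trans)
  then have N0: "of_nat ?N = (0::'a)"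
    by (simp only: of_nat_eq_0_iff_char_dvd)
  have "pderiv h = - 1"
    by (simp only: h_def pderiv_diff pderiv_monom N0) (simp add: one_pCons monom_0)
  \<comment> \<open>The field has at least two elements, so an irreducible factor of degree d
    satisfies 2^d <= N.\<close>
  define D where "D = nat \<lfloor>log 2 (real ?N)\<rfloor>"
  have "degree p \<le> D" if "irreducible p" "p dvd h" for p
  proof -
    have "(2::nat) ^ degree p \<le> card (UNIV :: 'a set) ^ degree p"
      using card_mono[of UNIV "{0, 1::'a}"] by (intro power_mono) auto
    also have "\<dots> \<le> ?N"
      using degree_irreducible_dvd_frobenius_poly[OF assms(1,2) N1 that(1)] that(2) by (simp add: h_def)
    finally have "real (degree p) \<le> log 2 (real ?N)"
      by (rule le_log2_of_power)
    then show ?thesis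
      by (simp add: D_def le_nat_floor)
  qed
  then obtain ts where ts: "bilin_mult_mod h ts" "length ts \<le> degree h * D"
    using ex_bilin_mult_mod_separable[OF \<open>pderiv h = - 1\<close>, of D h] by auto
  \<comment> \<open>Reducing the outputs modulo \<open>h\<close> turns the congruence into an
    equality whenever the product has degree below that of \<open>h\<close>.\<close>
  define us where "us = map (\<lambda>(a, b, c). (a, b, c mod h)) ts"
  have "x * y = bilin_sum us x y" if "degree x < n" "degree y < n" for x y
  proof -
    have "degree (x * y) < degree h"
      using degree_mult_le[of x y] that m \<open>degree h = ?N\<close> by linarith
    then have "x * y = x * y mod h" by (simp add: mod_poly_less)
    also have "\<dots> = bilin_sum ts x y mod h"
      using ts(1) by (simp add: bilin_mult_mod_def mod_eq_dvd_iff)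
    finally show ?thesis by (simp add: us_def bilin_sum_mod)
  qed
  moreover have "\<forall>(a, b, c)\<in>set us. linear_form a \<and> linear_form b"
    using ts(1) by (auto simp: us_def bilin_mult_mod_def)
  moreover have "real (length us) \<le> 2 * real n * real Q * log 2 (2 * real n * real Q)"
  proof -
    define N where "N = real ?N"
    have N: "N \<le> 2 * real n * real Q" "1 \<le> N"
      unfolding N_def using N_le N1
      by (metis of_nat_le_iff of_nat_mult of_nat_numeral, linarith)
    have "real D \<le> log 2 N"
      unfolding D_def N_def[symmetric] using N(2) by (intro of_nat_floor) simp
    also have "\<dots> \<le> log 2 (2 * real n * real Q)"
      using N by (intro log_mono) auto
    finally have D: "real D \<le> log 2 (2 * real n * real Q)" .
    have "length us \<le> ?N * D"
      using ts(2) by (simp add: us_def \<open>degree h = ?N\<close>)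
    then have "real (length us) \<le> N * real D"
      unfolding N_def by (metis of_nat_le_iff of_nat_mult)
    also have "\<dots> \<le> 2 * real n * real Q * log 2 (2 * real n * real Q)"
      using N D by (intro mult_mono) auto
    finally show ?thesis .
  qed
  ultimately show thesis using that by blast
qed

section \<open>The extension field\<close>

text \<open>Fermat's argument: if \<open>f\<close> does not divide \<open>x\<close>, multiplication
  by \<open>x\<close> permutes the nonzero residues. Comparing the products of all of them and
  cancelling, which is possible because \<open>f\<close> is prime, gives the claim.\<close>

lemma irreducible_dvd_power_card_minus:
  fixes f :: "'a::{finite,field} poly"
  assumes "irreducible f"
  shows "f dvd x ^ (card (UNIV :: 'a set) ^ degree f) - x"
proof (cases "f dvd x")
  case True
  have "card (UNIV :: 'a set) ^ degree f > 0" by (simp add: card_gt_0_iff)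
  then have "f dvd x ^ (card (UNIV :: 'a set) ^ degree f)"
    using True by (meson dvd_power dvd_trans)
  then show ?thesis using True by (rule dvd_diff)
next
  case False
  have f: "prime_elem f" using assms by (rule field_poly_irreducible_imp_prime)
  have f0: "f \<noteq> 0" using f by auto
  define R where "R = {g :: 'a poly. g = 0 \<or> degree g < degree f}"
  define S where "S = R - {0}"
  have fin: "finite R" "finite S"
    using finite_polys_degree_less by (auto simp: R_def S_def)
  have card: "Suc (card S) = card (UNIV :: 'a set) ^ degree f"
    unfolding card_polys_degree_less[where 'a = 'a and n = "degree f", symmetric] S_def
    using card_Suc_Diff1[OF fin(1), of 0] by (simp add: R_def)
  have not_dvd: "\<not> f dvd g" if "g \<in> S" for g
    using that dvd_imp_degree_le[of f g] by (auto simp: S_def R_def)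
  have "inj_on (\<lambda>g. x * g mod f) S"
  proof (rule inj_onI)
    fix g h assume gh: "g \<in> S" "h \<in> S" "x * g mod f = x * h mod f"
    then have "f dvd x * (g - h)"
      by (simp add: mod_eq_dvd_iff algebra_simps)
    then have "f dvd g - h"
      using f False prime_elem_dvd_multD by blast
    moreover have "g - h = 0 \<or> degree (g - h) < degree f"
      using gh by (auto simp: S_def R_def intro: degree_diff_less)
    ultimately show "g = h"
      using dvd_imp_degree_le[of f "g - h"] by fastforce
  qed
  moreover have "(\<lambda>g. x * g mod f) ` S \<subseteq> S"
  proof safe
    fix g assume "g \<in> S"
    then have "\<not> f dvd x * g"
      using not_dvd False f prime_elem_dvd_multD by blast
    then show "x * g mod f \<in> S"
      using degree_mod_less[OF f0, of "x * g"] by (auto simp: S_def R_def dvd_eq_mod_eq_0)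
  qed
  ultimately have bij: "bij_betw (\<lambda>g. x * g mod f) S S"
    using fin by (simp add: bij_betw_def endo_inj_surj)
  have "(\<Prod>g\<in>S. x * g mod f) = \<Prod>S"
    using prod.reindex_bij_betw[OF bij, of id] by simp
  then have "(\<Prod>g\<in>S. x * g) mod f = \<Prod>S mod f"
    using mod_prod_eq[of "\<lambda>g. x * g" f S] by simp
  then have "f dvd x ^ card S * \<Prod>S - \<Prod>S"
    by (simp add: mod_eq_dvd_iff prod.distrib)
  then have "f dvd (x ^ card S - 1) * \<Prod>S"
    by (simp add: algebra_simps)
  moreover have "\<not> f dvd \<Prod>S"
    using fin(2) not_dvd
  proof (induction S rule: finite_induct)
    case empty
    then show ?case using f by (simp add: prime_elem_not_unit)
  next
    case (insert g S)
    then show ?case using f by (simp add: prime_elem_dvd_mult_iff)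
  qed
  ultimately have "f dvd x * (x ^ card S - 1)"
    using f prime_elem_dvd_multD dvd_mult by blast
  then show ?thesis
    unfolding card[symmetric] by (simp add: algebra_simps)
qed

text \<open>As long as the exponent is at least N, Fermat allows N - 1 to be subtracted. The
  exponent stays positive, so the congruence also holds for \<open>x\<close> divisible by
  \<open>f\<close>.\<close>

lemma power_mod_irreducible_reduce:
  fixes f :: "'a::{finite,field} poly"
  assumes "irreducible f" and "k \<ge> 1"
  shows "\<exists>k' < card (UNIV :: 'a set) ^ degree f. \<forall>x. x ^ k mod f = x ^ k' mod f"
  using assms(2)
proof (induction k rule: less_induct)
  case (less k)
  let ?N = "card (UNIV :: 'a set) ^ degree f"
  have "2 \<le> card (UNIV :: 'a set)"
    using card_mono[of UNIV "{0, 1::'a}"] by simp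
  moreover have "degree f > 0"
    using assms(1) is_unit_iff_degree[of f] by (auto simp: irreducible_def)
  ultimately have N: "?N > 1"
    by (metis Suc_1 Suc_le_lessD one_less_power)
  show ?case
  proof (cases "k < ?N")
    case False
    define k1 where "k1 = k - ?N"
    have k: "k = k1 + ?N" using False by (simp add: k1_def)
    have "x ^ k mod f = x ^ Suc k1 mod f" for x
    proof -
      have "f dvd x ^ k1 * (x ^ ?N - x)"
        using irreducible_dvd_power_card_minus[OF assms(1)] by simp
      then show ?thesis
        by (simp add: mod_eq_dvd_iff k power_add algebra_simps)
    qed
    moreover have "\<exists>k' < ?N. \<forall>x. x ^ Suc k1 mod f = x ^ k' mod f"
      using N by (intro less.IH) (simp_all add: k)
    ultimately show ?thesis by simp
  qed auto
qed

text \<open>Base-\<open>Q\<close> expansion in which a digit d at position e is recorded as d copies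
  of e; each of the \<open>L\<close> positions contributes fewer than \<open>Q\<close>
  entries.\<close>

lemma ex_sum_powers:
  fixes Q :: nat
  assumes "k < Q ^ L"
  shows "\<exists>es. length es \<le> L * Q \<and> set es \<subseteq> {..<L} \<and> k = (\<Sum>e\<leftarrow>es. Q ^ e)"
  using assms
proof (induction L arbitrary: k)
  case (Suc L)
  have "Q > 0" using Suc.prems by (cases Q) auto
  then have "k mod Q ^ L < Q ^ L" by simp
  with Suc.IH obtain es where es: "length es \<le> L * Q" "set es \<subseteq> {..<L}" "k mod Q ^ L = (\<Sum>e\<leftarrow>es. Q ^ e)"
    by blast
  have "k div Q ^ L < Q"
    using Suc.prems by (simp add: less_mult_imp_div_less)
  moreover have "k = k div Q ^ L * Q ^ L + k mod Q ^ L"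
    by (rule div_mult_mod_eq[symmetric])
  ultimately show ?case
    using es by (intro exI[of _ "es @ replicate (k div Q ^ L) L"])
      (auto simp: sum_list_replicate split: if_splits)
qed auto

section \<open>Coordinates with respect to an arbitrary basis\<close>

lemma smult_sum_right: "smult c (\<Sum>i\<in>A. p i) = (\<Sum>i\<in>A. smult c (p i))"
  by (induction A rule: infinite_finite_induct) (simp_all add: smult_add_right)

text \<open>This justifies the definite description in \<open>coords\<close>: independence makes
  \<open>elem\<close> injective on lists of length \<open>n\<close>, and equal cardinalities make it
  surjective onto the reduced polynomials.\<close>

lemma ext_basis_coords:
  fixes f :: "'a::{finite,field} poly"
  assumes "ext_basis f \<beta> n" and "p = 0 \<or> degree p < n"
  shows "length (coords \<beta> n p) = n" and "elem \<beta> n (coords \<beta> n p) = p"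
    and "length c = n \<Longrightarrow> elem \<beta> n c = p \<Longrightarrow> coords \<beta> n p = c"
proof -
  let ?L = "{c :: 'a list. length c = n}" and ?P = "{p :: 'a poly. p = 0 \<or> degree p < n}"
  have n: "n > 0"
    using assms(1) is_unit_iff_degree[of f] by (auto simp: ext_basis_def irreducible_def)
  have indep: "\<forall>i<n. c i = 0" if "(\<Sum>i<n. smult (c i) (\<beta> i)) = 0" for c
    using assms(1) that by (simp add: ext_basis_def)
  have inj: "inj_on (elem \<beta> n) ?L"
  proof (rule inj_onI)
    fix c d assume cd: "c \<in> ?L" "d \<in> ?L" "elem \<beta> n c = elem \<beta> n d"
    then have "(\<Sum>i<n. smult (c ! i - d ! i) (\<beta> i)) = 0"
      by (simp add: elem_def smult_diff_left sum_subtractf)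
    then have "\<forall>i<n. c ! i - d ! i = 0"
      by (rule indep)
    then show "c = d"
      using cd by (simp add: list_eq_iff_nth_eq)
  qed
  have "elem \<beta> n ` ?L \<subseteq> ?P"
  proof safe
    fix c :: "'a list"
    assume "\<not> degree (elem \<beta> (length c) c) < length c"
    moreover have "degree (elem \<beta> n c) < n"
      unfolding elem_def using assms(1) n
      by (intro degree_sum_less) (auto simp: ext_basis_def intro: le_less_trans[OF degree_smult_le])
    moreover assume "n = length c"
    ultimately show "elem \<beta> (length c) c = 0" by simp
  qed
  moreover have "card (elem \<beta> n ` ?L) = card ?P"
    using card_image[OF inj] card_lists_length_eq[of "UNIV :: 'a set" n]
    by (simp add: card_polys_degree_less)
  ultimately have "elem \<beta> n ` ?L = ?P"
    by (intro card_subset_eq finite_polys_degree_less)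
  then have "p \<in> elem \<beta> n ` ?L"
    using assms(2) by blast
  then obtain d where d: "length d = n" "elem \<beta> n d = p" by blast
  have uniq: "c = d" if "length c = n" "elem \<beta> n c = p" for c
    using inj that d by (auto dest: inj_onD)
  have "coords \<beta> n p = d"
    unfolding coords_def using d uniq by (intro the_equality conjI) blast+
  then show "length (coords \<beta> n p) = n" "elem \<beta> n (coords \<beta> n p) = p"
    using d by simp_all
  show "coords \<beta> n p = c" if "length c = n" "elem \<beta> n c = p"
    using \<open>coords \<beta> n p = d\<close> uniq[OF that] by simp
qed

lemma ext_basis_mod:
  assumes "ext_basis f \<beta> n"
  shows "p mod f = 0 \<or> degree (p mod f) < n"
proof -
  have "f \<noteq> 0" "degree f = n"
    using assms by (auto simp: ext_basis_def)
  then show ?thesis using degree_mod_less[of f p] by simp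
qed

text \<open>Reduction modulo \<open>f\<close> and passage to coordinates are linear, so the
  coordinates of the fixed \<open>p i\<close> become constants of a linear map.\<close>

lemma coords_mod_lincomb:
  fixes f :: "'a::{finite,field} poly"
  assumes "ext_basis f \<beta> n" "j < n"
  shows "coords \<beta> n ((\<Sum>i\<in>A. smult (w i) (p i)) mod f) ! j = (\<Sum>i\<in>A. w i * coords \<beta> n (p i mod f) ! j)"
proof -
  let ?c = "map (\<lambda>j. \<Sum>i\<in>A. w i * coords \<beta> n (p i mod f) ! j) [0..<n]"
  have "elem \<beta> n ?c = (\<Sum>j<n. \<Sum>i\<in>A. smult (w i) (smult (coords \<beta> n (p i mod f) ! j) (\<beta> j)))"
    by (simp add: elem_def smult_sum)
  also have "\<dots> = (\<Sum>i\<in>A. smult (w i) (elem \<beta> n (coords \<beta> n (p i mod f))))"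
    by (subst sum.swap) (simp add: elem_def smult_sum_right)
  also have "\<dots> = (\<Sum>i\<in>A. smult (w i) (p i mod f))"
    using ext_basis_coords(2)[OF assms(1) ext_basis_mod[OF assms(1)]] by simp
  also have "\<dots> = (\<Sum>i\<in>A. smult (w i) (p i)) mod f"
    by (induction A rule: infinite_finite_induct) (auto simp: poly_mod_add_left mod_smult_left)
  finally have "coords \<beta> n ((\<Sum>i\<in>A. smult (w i) (p i)) mod f) = ?c"
    by (intro ext_basis_coords(3)[OF assms(1) ext_basis_mod[OF assms(1)]]) auto
  then show ?thesis using assms(2) by simp
qed

section \<open>Circuits\<close>

lemma run_snoc: "run xs (P @ [ins]) = run xs P @ [ieval xs (run xs P) ins]"
  by (simp add: run_def)

lemma length_run [simp]: "length (run xs P) = length P"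
  by (induction P rule: rev_induct) (simp_all add: run_snoc, simp add: run_def)

lemma depths_snoc: "depths (P @ [ins]) = depths P @ [idepth (depths P) ins]"
  by (simp add: depths_def)

lemma length_depths [simp]: "length (depths P) = length P"
  by (induction P rule: rev_induct) (simp_all add: depths_snoc, simp add: depths_def)

lemma wf_prog_snoc:
  assumes "wf_prog I P" "\<forall>j\<in>set (args ins). j < length P" "\<forall>i. ins = Inp i \<longrightarrow> i < I"
  shows "wf_prog I (P @ [ins])"
  using assms by (auto simp: wf_prog_def nth_append less_Suc_eq)

text \<open>No parallel step holds more multiplications than the whole program; every processor
  bound is obtained from a size bound in this way.\<close>

lemma mwidth_le_msize: "mwidth P \<le> msize P"
proof -
  have "card {k. k < length P \<and> is_mult (P ! k) \<and> depths P ! k = d} \<le> msize P" for d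
    unfolding msize_def length_filter_conv_card by (intro card_mono) auto
  then show ?thesis by (auto simp: mwidth_def)
qed

section \<open>Programs described by the functions they make available\<close>

definition avail :: "nat \<Rightarrow> 'a::comm_ring_1 instr list \<Rightarrow> ('a list \<Rightarrow> 'a) \<Rightarrow> nat \<Rightarrow> bool" where
  "avail I P F d \<longleftrightarrow> (\<exists>r<length P. depths P ! r \<le> d \<and> (\<forall>xs. length xs = I \<longrightarrow> run xs P ! r = F xs))"

lemma avail_snoc: "avail I P F d \<Longrightarrow> avail I (P @ [ins]) F d"
  by (auto simp: avail_def run_snoc depths_snoc nth_append intro: less_SucI)

text \<open>Hides the program and its register numbers, so that constructions compose without index
  bookkeeping: \<open>s\<close> bounds the multiplications, \<open>D\<close> the overall depth, and
  each function in \<open>T\<close> carries its own depth bound.\<close>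

definition circuit :: "nat \<Rightarrow> nat \<Rightarrow> nat \<Rightarrow> (('a::comm_ring_1 list \<Rightarrow> 'a) \<times> nat) set \<Rightarrow> bool" where
  "circuit I s D T \<longleftrightarrow> (\<exists>P. wf_prog I P \<and> msize P \<le> s \<and> (\<forall>d\<in>set (depths P). d \<le> D) \<and>
     (\<forall>(F, d)\<in>T. avail I P F d))"

lemma circuit_mono: "circuit I s D T \<Longrightarrow> s \<le> s' \<Longrightarrow> D \<le> D' \<Longrightarrow> T' \<subseteq> T \<Longrightarrow> circuit I s' D' T'"
  unfolding circuit_def by (meson order_trans subsetD)

lemma circuit_empty: "circuit I 0 0 {}"
  unfolding circuit_def
  by (rule exI[of _ "[]"]) (simp add: wf_prog_def msize_def depths_def)

text \<open>Appending one instruction keeps all earlier registers. The number \<open>k\<close> is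
  the budget for that instruction: with \<open>k = 0\<close> only free instructions pass the premise
  on \<open>is_mult\<close>.\<close>

lemma circuit_insert:
  assumes "circuit I s D T" "D \<le> D'"
    and step: "\<And>P. \<forall>d\<in>set (depths P). d \<le> D \<Longrightarrow> \<forall>(F, d)\<in>T. avail I P F d \<Longrightarrow>
      \<exists>ins. (\<forall>j\<in>set (args ins). j < length P) \<and> (\<forall>i. ins = Inp i \<longrightarrow> i < I) \<and> (is_mult ins \<longrightarrow> 0 < k) \<and>
        idepth (depths P) ins \<le> d \<and> idepth (depths P) ins \<le> D' \<and>
        (\<forall>xs. length xs = I \<longrightarrow> ieval xs (run xs P) ins = G xs)"
  shows "circuit I (s + k) D' (insert (G, d) T)"
proof -
  obtain P where P: "wf_prog I P" "msize P \<le> s" "\<forall>d\<in>set (depths P). d \<le> D" "\<forall>(F, d)\<in>T. avail I P F d"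
    using assms(1) by (auto simp: circuit_def)
  obtain ins where ins: "\<forall>j\<in>set (args ins). j < length P" "\<forall>i. ins = Inp i \<longrightarrow> i < I"
      "is_mult ins \<longrightarrow> 0 < k" "idepth (depths P) ins \<le> d" "idepth (depths P) ins \<le> D'"
      "\<forall>xs. length xs = I \<longrightarrow> ieval xs (run xs P) ins = G xs"
    using step[OF P(3,4)] by blast
  have "wf_prog I (P @ [ins])"
    using P(1) ins(1,2) by (rule wf_prog_snoc)
  moreover have "msize (P @ [ins]) \<le> s + k"
    using P(2) ins(3) by (auto simp: msize_def)
  moreover have "\<forall>d\<in>set (depths (P @ [ins])). d \<le> D'"
    using P(3) assms(2) ins(5) by (auto simp: depths_snoc)
  moreover have "avail I (P @ [ins]) G d"
    unfolding avail_def using ins(4,6)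
    by (intro exI[of _ "length P"]) (simp add: run_snoc depths_snoc nth_append)
  ultimately show ?thesis
    using P(4) avail_snoc unfolding circuit_def by (intro exI[of _ "P @ [ins]"]) fast
qed

lemma circuit_weaken:
  assumes "circuit I s D T" "(F, d) \<in> T" "d \<le> e" "\<And>xs. length xs = I \<Longrightarrow> F xs = G xs"
  shows "circuit I s D (insert (G, e) T)"
proof -
  have "avail I P G e" if "avail I P F d" for P
    using that assms(3,4) unfolding avail_def by (metis order_trans)
  then show ?thesis
    using assms(1,2) unfolding circuit_def by fast
qed

lemma circuit_Inp: "circuit I s D T \<Longrightarrow> i < I \<Longrightarrow> circuit I s D (insert (\<lambda>xs. xs ! i, d) T)"
  by (rule circuit_insert[of I s D T D 0, simplified]) (auto intro!: exI[of _ "Inp i"])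

lemma circuit_Cst: "circuit I s D T \<Longrightarrow> circuit I s D (insert (\<lambda>xs. c, d) T)"
  by (rule circuit_insert[of I s D T D 0, simplified]) (auto intro!: exI[of _ "Cst c"])

lemma circuit_Add:
  assumes "circuit I s D T" "(F, d) \<in> T" "(G, d) \<in> T"
  shows "circuit I s D (insert (\<lambda>xs. F xs + G xs, d) T)"
proof -
  have "circuit I (s + 0) D (insert (\<lambda>xs. F xs + G xs, d) T)"
  proof (rule circuit_insert[OF assms(1)])
    fix P assume P: "\<forall>d\<in>set (depths P). d \<le> D" "\<forall>(F, d)\<in>T. avail I P F d"
    from P(2) assms(2,3) have "avail I P F d" "avail I P G d" by auto
    then obtain r r' where "r < length P" "depths P ! r \<le> d" "\<forall>xs. length xs = I \<longrightarrow> run xs P ! r = F xs"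
      "r' < length P" "depths P ! r' \<le> d" "\<forall>xs. length xs = I \<longrightarrow> run xs P ! r' = G xs"
      by (auto simp: avail_def)
    moreover from this have "depths P ! r \<le> D" "depths P ! r' \<le> D"
      using P(1) by auto
    ultimately show "\<exists>ins. (\<forall>j\<in>set (args ins). j < length P) \<and> (\<forall>i. ins = Inp i \<longrightarrow> i < I) \<and>
        (is_mult ins \<longrightarrow> (0::nat) < 0) \<and> idepth (depths P) ins \<le> d \<and> idepth (depths P) ins \<le> D \<and>
        (\<forall>xs. length xs = I \<longrightarrow> ieval xs (run xs P) ins = F xs + G xs)"
      by (intro exI[of _ "Add r r'"]) auto
  qed simp
  then show ?thesis by simp
qed

lemma circuit_Mul:
  assumes "circuit I s D T" "(F, d) \<in> T" "(G, d) \<in> T"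
  shows "circuit I (Suc s) (max D (Suc d)) (insert (\<lambda>xs. F xs * G xs, Suc d) T)"
proof -
  have "circuit I (s + 1) (max D (Suc d)) (insert (\<lambda>xs. F xs * G xs, Suc d) T)"
  proof (rule circuit_insert[OF assms(1)])
    fix P assume P: "\<forall>(F, d)\<in>T. avail I P F d"
    from P assms(2,3) have "avail I P F d" "avail I P G d" by auto
    then obtain r r' where "r < length P" "depths P ! r \<le> d" "\<forall>xs. length xs = I \<longrightarrow> run xs P ! r = F xs"
      "r' < length P" "depths P ! r' \<le> d" "\<forall>xs. length xs = I \<longrightarrow> run xs P ! r' = G xs"
      by (auto simp: avail_def)
    then show "\<exists>ins. (\<forall>j\<in>set (args ins). j < length P) \<and> (\<forall>i. ins = Inp i \<longrightarrow> i < I) \<and>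
        (is_mult ins \<longrightarrow> (0::nat) < 1) \<and> idepth (depths P) ins \<le> Suc d \<and>
        idepth (depths P) ins \<le> max D (Suc d) \<and>
        (\<forall>xs. length xs = I \<longrightarrow> ieval xs (run xs P) ins = F xs * G xs)"
      by (intro exI[of _ "Mul r r'"]) auto
  qed simp
  then show ?thesis by simp
qed

text \<open>Everything that a program computing \<open>T\<close> can compute without further multiplications.\<close>
inductive_set free :: "nat \<Rightarrow> (('a::comm_ring_1 list \<Rightarrow> 'a) \<times> nat) set \<Rightarrow> (('a list \<Rightarrow> 'a) \<times> nat) set"
  for I :: nat and T :: "(('a list \<Rightarrow> 'a) \<times> nat) set"
where
  base: "x \<in> T \<Longrightarrow> x \<in> free I T"
| input: "i < I \<Longrightarrow> (\<lambda>xs. xs ! i, d) \<in> free I T"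
| const: "(\<lambda>xs. c, d) \<in> free I T"
| add: "(F, d) \<in> free I T \<Longrightarrow> (G, d) \<in> free I T \<Longrightarrow> (\<lambda>xs. F xs + G xs, d) \<in> free I T"
| weaken: "(F, d) \<in> free I T \<Longrightarrow> d \<le> e \<Longrightarrow> (\<And>xs. length xs = I \<Longrightarrow> F xs = G xs) \<Longrightarrow> (G, e) \<in> free I T"

lemma free_mono:
  assumes "x \<in> free I T" "T \<subseteq> T'"
  shows "x \<in> free I T'"
  using assms(1)
proof induction
  case (base x)
  then show ?case using assms(2) by (auto intro: free.base)
next
  case (weaken F d e G)
  show ?case using weaken.IH weaken.hyps(2,3) by (rule free.weaken)
qed (auto intro: free.intros)

text \<open>Stated for every \<open>T'\<close> above \<open>T\<close>, so that in the sum case the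
  second summand can be realised on top of the first within one program.\<close>

lemma circuit_free_insert:
  assumes "x \<in> free I T" "circuit I s D T'" "T \<subseteq> T'"
  shows "circuit I s D (insert x T')"
  using assms
proof (induction arbitrary: T')
  case (base x)
  then show ?case by (metis insert_absorb subsetD)
next
  case (add F d G)
  then have "circuit I s D (insert (G, d) (insert (F, d) T'))" by blast
  from circuit_Add[OF this, of F d G]
  have "circuit I s D (insert (\<lambda>xs. F xs + G xs, d) (insert (G, d) (insert (F, d) T')))" by simp
  then show ?case by (rule circuit_mono) auto
next
  case (weaken F d e G)
  then have "circuit I s D (insert (F, d) T')" by blast
  from circuit_weaken[OF this _ weaken.hyps(2,3)]
  have "circuit I s D (insert (G, e) (insert (F, d) T'))" by simp
  then show ?case by (rule circuit_mono) auto
qed (auto intro: circuit_Inp circuit_Cst)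

lemma circuit_free_Un:
  assumes "finite S" "S \<subseteq> free I T" "circuit I s D T"
  shows "circuit I s D (T \<union> S)"
  using assms
proof (induction S rule: finite_induct)
  case (insert x S)
  then show ?case
    using circuit_free_insert[of x I T s D "T \<union> S"] by auto
qed auto

text \<open>All factors come from the original \<open>T\<close> at the common depth
  \<open>d\<close>, so the products form one parallel layer, whatever their number.\<close>

lemma circuit_mults:
  assumes "circuit I s D T" "\<And>F G. (F, G) \<in> set gs \<Longrightarrow> (F, d) \<in> free I T \<and> (G, d) \<in> free I T"
  shows "circuit I (s + length gs) (max D (Suc d)) (T \<union> (\<lambda>(F, G). (\<lambda>xs. F xs * G xs, Suc d)) ` set gs)"
  using assms(2)
proof (induction gs)
  case Nil
  then show ?case using assms(1) by (auto intro: circuit_mono)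
next
  case (Cons g gs)
  obtain F G where g: "g = (F, G)" by (cases g)
  let ?T = "T \<union> (\<lambda>(F, G). (\<lambda>xs. F xs * G xs, Suc d)) ` set gs"
  have "(F, d) \<in> free I ?T" "(G, d) \<in> free I ?T"
    using Cons.prems[of F G] g by (auto intro: free_mono)
  moreover have "circuit I (s + length gs) (max D (Suc d)) ?T"
    by (rule Cons.IH) (rule Cons.prems, simp)
  ultimately have "circuit I (s + length gs) (max D (Suc d)) (?T \<union> {(F, d), (G, d)})"
    by (intro circuit_free_Un[of "{(F, d), (G, d)}" I ?T]) simp_all
  from circuit_Mul[OF this, of F d G]
  have "circuit I (Suc (s + length gs)) (max D (Suc d))
      (insert (\<lambda>xs. F xs * G xs, Suc d) (?T \<union> {(F, d), (G, d)}))" by simp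
  then show ?case by (rule circuit_mono) (auto simp: g)
qed

text \<open>One layer multiplies each listed value by every element of the finite field; afterwards
  any linear map of these values is a sum of available quantities and hence free.\<close>

lemma circuit_scalings:
  fixes T :: "(('a::{finite,field} list \<Rightarrow> 'a) \<times> nat) set"
  assumes "circuit I s D T" "\<And>F. F \<in> set Fs \<Longrightarrow> (F, d) \<in> free I T"
  obtains T' where "T \<subseteq> T'" "circuit I (s + card (UNIV :: 'a set) * length Fs) (max D (Suc d)) T'"
    "\<And>F c. F \<in> set Fs \<Longrightarrow> (\<lambda>xs. c * F xs, Suc d) \<in> free I T'"
proof -
  obtain cs :: "'a list" where cs: "set cs = UNIV" "length cs = card (UNIV :: 'a set)"
    using finite_distinct_list[of "UNIV :: 'a set"] distinct_card by (metis finite)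
  define gs where "gs = map (\<lambda>(c, F). (\<lambda>xs :: 'a list. c, F)) (List.product cs Fs)"
  have "circuit I (s + length gs) (max D (Suc d)) (T \<union> (\<lambda>(F, G). (\<lambda>xs. F xs * G xs, Suc d)) ` set gs)"
    using assms by (intro circuit_mults) (auto simp: gs_def intro: free.const)
  moreover have "(\<lambda>xs. c * F xs, Suc d) \<in> free I (T \<union> (\<lambda>(F, G). (\<lambda>xs. F xs * G xs, Suc d)) ` set gs)"
    if "F \<in> set Fs" for c F
    using that cs by (intro free.base UnI2 image_eqI[of _ _ "(\<lambda>xs. c, F)"]) (auto simp: gs_def)
  ultimately show thesis
    using cs by (intro that[of "T \<union> (\<lambda>(F, G). (\<lambda>xs. F xs * G xs, Suc d)) ` set gs"]) (auto simp: gs_def)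
qed

lemma free_sum:
  assumes "\<And>i. i \<in> A \<Longrightarrow> (F i, d) \<in> free I T"
  shows "(\<lambda>xs. \<Sum>i\<in>A. F i xs, d) \<in> free I T"
  using assms
proof (induction A rule: infinite_finite_induct)
  case (insert i A)
  then show ?case using free.add[of "F i" d I T "\<lambda>xs. \<Sum>i\<in>A. F i xs"] by simp
qed (auto intro: free.const)

text \<open>Returns from sets of functions to a concrete program with chosen output
  registers.\<close>

lemma circuit_computes:
  assumes "circuit I s D T" "\<And>G. G \<in> set Gs \<Longrightarrow> (G, d) \<in> free I T"
    and "\<And>xs. length xs = I \<Longrightarrow> F xs = map (\<lambda>G. G xs) Gs"
  shows "\<exists>P outs. computes I P outs F \<and> mdepth P \<le> D \<and> mwidth P \<le> s \<and> msize P \<le> s"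
proof -
  have "circuit I s D (T \<union> (\<lambda>G. (G, d)) ` set Gs)"
    using assms(1,2) by (intro circuit_free_Un) auto
  then obtain P where P: "wf_prog I P" "msize P \<le> s" "\<forall>d\<in>set (depths P). d \<le> D"
      "\<forall>G\<in>set Gs. avail I P G d"
    unfolding circuit_def by fast
  then obtain r where r: "\<forall>G\<in>set Gs. r G < length P \<and> (\<forall>xs. length xs = I \<longrightarrow> run xs P ! r G = G xs)"
    unfolding avail_def by metis
  have "computes I P (map r Gs) F"
    using P(1) r assms(3) by (auto simp: computes_def)
  moreover have "mdepth P \<le> D"
    using P(3) by (auto simp: mdepth_def)
  ultimately show ?thesis
    using P(2) mwidth_le_msize[of P] order_trans by blast
qed

section \<open>Circuits for the extension field\<close>

lemma linear_form_sum:
  assumes "linear_form a"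
  shows "a (\<Sum>i\<in>A. smult (c i) (p i)) = (\<Sum>i\<in>A. c i * a (p i))"
proof -
  have "a (smult 0 0) = 0"
    using assms unfolding linear_form_def by (metis mult_zero_left)
  then show ?thesis
    using assms by (induction A rule: infinite_finite_induct) (simp_all add: linear_form_def)
qed

text \<open>Serves to pad a product to the leaves of a full binary tree while at most doubling the
  number of factors. In the induction the exponent changes only when \<open>M\<close> is itself the
  power of two.\<close>

lemma ex_power_of_two_between:
  assumes "M \<ge> (1::nat)"
  shows "\<exists>t. M \<le> 2 ^ t \<and> 2 ^ t \<le> 2 * M"
  using assms
proof (induction M rule: nat_induct_at_least)
  case base
  show ?case by (rule exI[of _ 0]) simp
next
  case (Suc M)
  then obtain t where t: "M \<le> 2 ^ t" "2 ^ t \<le> 2 * M" by blast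
  show ?case
  proof (cases "M = 2 ^ t")
    case True
    then show ?thesis using Suc.hyps by (intro exI[of _ "Suc t"]) auto
  next
    case False
    then show ?thesis using t by (intro exI[of _ t]) auto
  qed
qed

text \<open>The bilinear formula \<open>ts\<close> is arbitrary here; it enters the cost bounds only
  through its length.\<close>

locale field_mult =
  fixes f :: "'a::{finite,field} poly" and \<beta> :: "nat \<Rightarrow> 'a poly" and n :: nat
    and ts :: "(('a poly \<Rightarrow> 'a) \<times> ('a poly \<Rightarrow> 'a) \<times> 'a poly) list"
  assumes basis: "ext_basis f \<beta> n"
    and linear: "\<forall>(a, b, c)\<in>set ts. linear_form a \<and> linear_form b"
    and mult: "\<And>x y. degree x < n \<Longrightarrow> degree y < n \<Longrightarrow> x * y = bilin_sum ts x y"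
begin

text \<open>The three summands are the three layers of a field multiplication: all scalings of the
  \<open>2 * n\<close> coordinates, the bilinear products, and all scalings of those
  products.\<close>

definition cost :: nat where
  "cost = card (UNIV :: 'a set) * (2 * n) + length ts + card (UNIV :: 'a set) * length ts"

text \<open>Only the residue of \<open>g\<close> modulo \<open>f\<close> has to be available, so
  \<open>g\<close> itself may be an unreduced product or power.\<close>

definition res_avail :: "nat \<Rightarrow> (('a list \<Rightarrow> 'a) \<times> nat) set \<Rightarrow> ('a list \<Rightarrow> 'a poly) \<Rightarrow> nat \<Rightarrow> bool" where
  "res_avail I T g d \<longleftrightarrow> (\<forall>j<n. (\<lambda>xs. coords \<beta> n (g xs mod f) ! j, d) \<in> free I T)"

lemma n_pos: "n > 0" and degree_f: "degree f = n"
  using basis is_unit_iff_degree[of f] by (auto simp: ext_basis_def irreducible_def)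

lemma degree_mod_f: "degree (p mod f) < n"
  using ext_basis_mod[OF basis, of p] n_pos by auto

lemma length_coords_mod: "length (coords \<beta> n (p mod f)) = n"
  by (rule ext_basis_coords(1)[OF basis ext_basis_mod[OF basis]])

lemma mod_f_eq_sum: "p mod f = (\<Sum>j<n. smult (coords \<beta> n (p mod f) ! j) (\<beta> j))"
  using ext_basis_coords(2)[OF basis ext_basis_mod[OF basis], of p] by (simp add: elem_def)

lemma elem_mod_f: "elem \<beta> n c mod f = elem \<beta> n c"
proof -
  have "degree (elem \<beta> n c) < n"
    unfolding elem_def using basis n_pos
    by (intro degree_sum_less) (auto simp: ext_basis_def intro: le_less_trans[OF degree_smult_le])
  then show ?thesis by (simp add: mod_poly_less degree_f)
qed

lemma res_avail_mono: "res_avail I T g d \<Longrightarrow> T \<subseteq> T' \<Longrightarrow> res_avail I T' g d"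
  unfolding res_avail_def using free_mono by blast

lemma res_avail_elem:
  assumes "\<And>xs. length xs = I \<Longrightarrow> length (c xs) = n" "\<And>j. j < n \<Longrightarrow> (\<lambda>xs. c xs ! j, d) \<in> free I T"
  shows "res_avail I T (\<lambda>xs. elem \<beta> n (c xs)) d"
  unfolding res_avail_def
proof (intro allI impI)
  fix j assume "j < n"
  have "coords \<beta> n (elem \<beta> n (c xs) mod f) = c xs" if "length xs = I" for xs
    using ext_basis_coords(3)[OF basis ext_basis_mod[OF basis], of "c xs" "elem \<beta> n (c xs)"]
      assms(1)[OF that] elem_mod_f by simp
  then show "(\<lambda>xs. coords \<beta> n (elem \<beta> n (c xs) mod f) ! j, d) \<in> free I T"
    by (intro free.weaken[OF assms(2)[OF \<open>j < n\<close>]]) auto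
qed

text \<open>A linear form is determined by its constants \<open>a (\<beta> j)\<close>; once the
  scaled coordinates exist, only additions remain.\<close>

lemma free_linear_form:
  assumes "linear_form a" "\<And>j c. j < n \<Longrightarrow> (\<lambda>xs. c * coords \<beta> n (g xs mod f) ! j, d) \<in> free I T"
  shows "(\<lambda>xs. a (g xs mod f), d) \<in> free I T"
proof -
  have "(\<lambda>xs. \<Sum>j<n. a (\<beta> j) * coords \<beta> n (g xs mod f) ! j, d) \<in> free I T"
    using assms(2) by (intro free_sum) simp
  moreover have "a (p mod f) = (\<Sum>j<n. a (\<beta> j) * coords \<beta> n (p mod f) ! j)" for p
    by (subst mod_f_eq_sum) (simp add: linear_form_sum[OF assms(1)] mult.commute)
  ultimately show ?thesis by simp
qed

text \<open>Scale the coordinates, multiply the linear forms, scale the products: three layers, with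
  free additions in between that form the linear maps.\<close>

lemma circuit_field_mult:
  assumes "circuit I s D T" "res_avail I T g d" "res_avail I T h d"
  obtains T' where "T \<subseteq> T'" "circuit I (s + cost) (max D (d + 3)) T'"
    "res_avail I T' (\<lambda>xs. g xs * h xs) (d + 3)"
proof -
  define Fs where "Fs = map (\<lambda>j xs. coords \<beta> n (g xs mod f) ! j) [0..<n] @
    map (\<lambda>j xs. coords \<beta> n (h xs mod f) ! j) [0..<n]"
  have "(F, d) \<in> free I T" if "F \<in> set Fs" for F
    using that assms(2,3) by (auto simp: Fs_def res_avail_def)
  from circuit_scalings[OF assms(1) this] obtain T1 where T1: "T \<subseteq> T1"
      "circuit I (s + card (UNIV :: 'a set) * length Fs) (max D (Suc d)) T1"
      "\<And>F c. F \<in> set Fs \<Longrightarrow> (\<lambda>xs. c * F xs, Suc d) \<in> free I T1"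
    by blast
  have g1: "(\<lambda>xs. a (g xs mod f), Suc d) \<in> free I T1" if "linear_form a" for a
    by (rule free_linear_form[OF that], rule T1(3)) (simp add: Fs_def)
  have h1: "(\<lambda>xs. a (h xs mod f), Suc d) \<in> free I T1" if "linear_form a" for a
    by (rule free_linear_form[OF that], rule T1(3)) (simp add: Fs_def)
  define gs where "gs = map (\<lambda>(a, b, c). (\<lambda>xs. a (g xs mod f), \<lambda>xs. b (h xs mod f))) ts"
  define T2 where "T2 = T1 \<union> (\<lambda>(F, G). (\<lambda>xs. F xs * G xs, Suc (Suc d))) ` set gs"
  have T2: "circuit I (s + card (UNIV :: 'a set) * length Fs + length gs)
      (max (max D (Suc d)) (Suc (Suc d))) T2"
    unfolding T2_def
    by (rule circuit_mults[OF T1(2)]) (use linear g1 h1 in \<open>auto simp: gs_def\<close>)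
  define Ps where "Ps = map (\<lambda>(F, G) xs. F xs * G xs) gs"
  have "(F, Suc (Suc d)) \<in> free I T2" if "F \<in> set Ps" for F
    using that by (auto simp: Ps_def T2_def intro!: free.base)
  from circuit_scalings[OF T2 this] obtain T3 where T3: "T2 \<subseteq> T3"
      "circuit I (s + card (UNIV :: 'a set) * length Fs + length gs + card (UNIV :: 'a set) * length Ps)
        (max (max (max D (Suc d)) (Suc (Suc d))) (Suc (Suc (Suc d)))) T3"
      "\<And>F c. F \<in> set Ps \<Longrightarrow> (\<lambda>xs. c * F xs, Suc (Suc (Suc d))) \<in> free I T3"
    by blast
  have "circuit I (s + cost) (max D (d + 3)) T3"
    by (rule circuit_mono[OF T3(2)]; simp add: cost_def Fs_def gs_def Ps_def; arith)
  moreover have "T \<subseteq> T3" using T1(1) T3(1) by (auto simp: T2_def)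
  moreover have "res_avail I T3 (\<lambda>xs. g xs * h xs) (d + 3)"
    unfolding res_avail_def
  proof (intro allI impI)
    fix j assume "j < n"
    define c where "c r = snd (snd (ts ! r))" for r
    \<comment> \<open>Reduction modulo \<open>f\<close> costs nothing extra: it is absorbed into the
      constants, the coordinates of the outputs \<open>c r\<close> modulo \<open>f\<close>.\<close>
    have "(\<lambda>xs. \<Sum>r<length ts. coords \<beta> n (c r mod f) ! j * (Ps ! r) xs, Suc (Suc (Suc d))) \<in> free I T3"
      by (intro free_sum T3(3)) (simp add: Ps_def gs_def)
    moreover have "coords \<beta> n (g xs * h xs mod f) ! j =
        (\<Sum>r<length ts. coords \<beta> n (c r mod f) ! j * (Ps ! r) xs)" for xs
    proof -
      have "g xs * h xs mod f = bilin_sum ts (g xs mod f) (h xs mod f) mod f"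
        by (subst mult[symmetric]) (simp_all add: degree_mod_f mod_mult_eq)
      also have "bilin_sum ts (g xs mod f) (h xs mod f) = (\<Sum>r<length ts. smult ((Ps ! r) xs) (c r))"
        by (simp add: bilin_sum_def sum_list_sum_nth Ps_def gs_def c_def split_def atLeast0LessThan)
      finally show ?thesis
        by (simp add: coords_mod_lincomb[OF basis \<open>j < n\<close>] mult.commute)
    qed
    ultimately show "(\<lambda>xs. coords \<beta> n (g xs * h xs mod f) ! j, d + 3) \<in> free I T3"
      by (simp add: numeral_3_eq_3)
  qed
  ultimately show thesis by (intro that)
qed

text \<open>A full binary tree with \<open>2 ^ t\<close> leaves has \<open>2 ^ t - 1\<close> inner
  nodes, and each of its \<open>t\<close> levels adds depth 3.\<close>

lemma circuit_prod:
  fixes g :: "nat \<Rightarrow> 'a list \<Rightarrow> 'a poly"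
  assumes "circuit I s D T" "\<And>i. i < 2 ^ t \<Longrightarrow> res_avail I T (g i) d"
  shows "\<exists>T'. T \<subseteq> T' \<and> circuit I (s + (2 ^ t - 1) * cost) (max D (d + 3 * t)) T' \<and>
    res_avail I T' (\<lambda>xs. \<Prod>i<2 ^ t. g i xs) (d + 3 * t)"
  using assms
proof (induction t arbitrary: s D T g)
  case 0
  then have "res_avail I T (g 0) d" by simp
  then show ?case
    using circuit_mono[OF 0(1), of s "max D d" T] by (intro exI[of _ T]) simp
next
  case (Suc t)
  let ?N = "2 ^ t :: nat"
  from Suc.IH[OF Suc.prems(1), of g] Suc.prems(2) obtain T1 where T1: "T \<subseteq> T1"
      "circuit I (s + (?N - 1) * cost) (max D (d + 3 * t)) T1"
      "res_avail I T1 (\<lambda>xs. \<Prod>i<?N. g i xs) (d + 3 * t)"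
    by auto
  \<comment> \<open>The second half extends the program of the first, but its leaves still have
    depth \<open>d\<close>; both halves therefore finish at the same depth.\<close>
  have "res_avail I T1 (g (?N + i)) d" if "i < ?N" for i
    using that by (intro res_avail_mono[OF Suc.prems(2) T1(1)]) simp
  from Suc.IH[of _ _ _ "\<lambda>i. g (?N + i)", OF T1(2) this] obtain T2 where T2: "T1 \<subseteq> T2"
      "circuit I (s + (?N - 1) * cost + (?N - 1) * cost) (max (max D (d + 3 * t)) (d + 3 * t)) T2"
      "res_avail I T2 (\<lambda>xs. \<Prod>i<?N. g (?N + i) xs) (d + 3 * t)"
    by blast
  obtain T3 where T3: "T2 \<subseteq> T3"
      "circuit I (s + (?N - 1) * cost + (?N - 1) * cost + cost)
        (max (max (max D (d + 3 * t)) (d + 3 * t)) (d + 3 * t + 3)) T3"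
      "res_avail I T3 (\<lambda>xs. (\<Prod>i<?N. g i xs) * (\<Prod>i<?N. g (?N + i) xs)) (d + 3 * t + 3)"
    using circuit_field_mult[OF T2(2) res_avail_mono[OF T1(3) T2(1)] T2(3)] by blast
  have "(\<Prod>i<?N. p i) * (\<Prod>i<?N. p (?N + i)) = (\<Prod>i<2 ^ Suc t. p i)" for p :: "nat \<Rightarrow> 'a poly"
    using prod.atLeastLessThan_concat[of 0 ?N "2 ^ Suc t" p] prod.shift_bounds_nat_ivl[of p 0 ?N ?N]
    by (simp add: atLeast0LessThan add.commute mult_2)
  note prod_split = this[of "\<lambda>i. g i xs" for xs]
  have "circuit I (s + (2 ^ Suc t - 1) * cost) (max D (d + 3 * Suc t)) T3"
  proof (rule circuit_mono[OF T3(2)])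
    obtain k where "?N = Suc k" by (metis not0_implies_Suc power_not_zero zero_neq_numeral)
    then show "s + (?N - 1) * cost + (?N - 1) * cost + cost \<le> s + (2 ^ Suc t - 1) * cost"
      by (simp add: algebra_simps)
  qed auto
  moreover have "res_avail I T3 (\<lambda>xs. \<Prod>i<2 ^ Suc t. g i xs) (d + 3 * Suc t)"
    unfolding prod_split[symmetric] using T3(3) by (simp add: algebra_simps)
  ultimately show ?case
    using T1(1) T2(1) T3(1) by blast
qed

text \<open>The products are appended one after another, yet each starts from inputs at depth 0, so
  the total depth stays 3 while sizes add.\<close>

lemma fmul_many_computes:
  "\<exists>P outs. computes (2 * n * m) P outs (fmul_many f \<beta> n m) \<and>
     mdepth P \<le> 3 \<and> mwidth P \<le> m * cost \<and> msize P \<le> m * cost"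
proof -
  define I where "I = 2 * n * m"
  define c where "c t xs = take (2 * n) (drop (2 * n * t) xs)" for t and xs :: "'a list"
  have le: "2 * n * t + 2 * n \<le> I" if "t < m" for t
    using mult_le_mono2[of "Suc t" m "2 * n"] that by (simp add: I_def)
  have "\<exists>T. circuit I (k * cost) 3 T \<and>
      (\<forall>t<k. res_avail I T (\<lambda>xs. elem \<beta> n (take n (c t xs)) * elem \<beta> n (drop n (c t xs))) 3)"
    if "k \<le> m" for k
    using that
  proof (induction k)
    case 0
    show ?case using circuit_mono[OF circuit_empty, of 0 3 "{}"] by auto
  next
    case (Suc k)
    then obtain T where T: "circuit I (k * cost) 3 T" "\<forall>t<k. res_avail I T
        (\<lambda>xs. elem \<beta> n (take n (c t xs)) * elem \<beta> n (drop n (c t xs))) 3"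
      by auto
    have k: "2 * n * k + 2 * n \<le> I" using Suc.prems le by auto
    have "res_avail I T (\<lambda>xs. elem \<beta> n (take n (c k xs))) 0"
    proof (rule res_avail_elem)
      show "(\<lambda>xs. take n (c k xs) ! j, 0) \<in> free I T" if "j < n" for j
        by (rule free.weaken[OF free.input[of "2 * n * k + j"]]) (use k that in \<open>auto simp: c_def\<close>)
    qed (use k in \<open>simp add: c_def\<close>)
    moreover have "res_avail I T (\<lambda>xs. elem \<beta> n (drop n (c k xs))) 0"
    proof (rule res_avail_elem)
      show "(\<lambda>xs. drop n (c k xs) ! j, 0) \<in> free I T" if "j < n" for j
        \<comment> \<open>Block \<open>k\<close> starts at position \<open>2 * n * k\<close>; its
          second factor is shifted by a further \<open>n\<close>.\<close>
        by (rule free.weaken[OF free.input[of "2 * n * k + (n + j)"]]) (use k that in \<open>auto simp: c_def\<close>)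
    qed (use k in \<open>simp add: c_def\<close>)
    ultimately obtain T' where T': "T \<subseteq> T'" "circuit I (k * cost + cost) (max 3 (0 + 3)) T'"
        "res_avail I T' (\<lambda>xs. elem \<beta> n (take n (c k xs)) * elem \<beta> n (drop n (c k xs))) (0 + 3)"
      using circuit_field_mult[OF T(1)] by blast
    then show ?case
      using T(2) res_avail_mono[OF _ T'(1)] by (intro exI[of _ T']) (auto simp: less_Suc_eq add.commute)
  qed
  then obtain T where T: "circuit I (m * cost) 3 T" "\<forall>t<m. res_avail I T
      (\<lambda>xs. elem \<beta> n (take n (c t xs)) * elem \<beta> n (drop n (c t xs))) 3"
    by blast
  define Gs where "Gs = concat (map (\<lambda>t. map (\<lambda>j xs.
    coords \<beta> n (elem \<beta> n (take n (c t xs)) * elem \<beta> n (drop n (c t xs)) mod f) ! j) [0..<n]) [0..<m])"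
  have nth: "map (\<lambda>j. l ! j) [0..<n] = l" if "length l = n" for l :: "'a list"
    using map_nth[of l] that by simp
  have "fmul_many f \<beta> n m xs = map (\<lambda>G. G xs) Gs" for xs
    by (simp add: Gs_def fmul_many_def fmul_def map_concat comp_def c_def[symmetric] nth length_coords_mod)
  moreover have "(G, 3) \<in> free I T" if "G \<in> set Gs" for G
    using that T(2) by (auto simp: Gs_def res_avail_def)
  ultimately show ?thesis
    using circuit_computes[OF T(1), of Gs 3 "fmul_many f \<beta> n m"] unfolding I_def by blast
qed

lemma fmul_computes:
  "\<exists>P outs. computes (2 * n) P outs (fmul f \<beta> n) \<and> mdepth P \<le> 3 \<and> mwidth P \<le> cost \<and> msize P \<le> cost"
proof -
  have "fmul_many f \<beta> n 1 xs = fmul f \<beta> n xs" if "length xs = 2 * n" for xs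
    using that by (simp add: fmul_many_def)
  then have "computes (2 * n) P outs (fmul f \<beta> n)" if "computes (2 * n * 1) P outs (fmul_many f \<beta> n 1)" for P outs
    using that by (simp add: computes_def)
  then show ?thesis using fmul_many_computes[of 1] by (metis mult_1)
qed

lemma fpow_computes:
  assumes "\<forall>c::'a. c ^ Q = c" "Q = CHAR('a) ^ i" "Q > 1" "k \<ge> 1"
  defines "M \<equiv> card (UNIV :: 'a set) * n * Q"
  shows "\<exists>P outs t. computes n P outs (fpow f \<beta> n k) \<and> 2 ^ t \<le> 2 * M \<and> mdepth P \<le> 1 + 3 * t \<and>
    mwidth P \<le> card (UNIV :: 'a set) * n + 2 * M * cost \<and>
    msize P \<le> card (UNIV :: 'a set) * n + 2 * M * cost"
proof -
  let ?q = "card (UNIV :: 'a set)"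
  have q: "?q > 0" by (simp add: card_gt_0_iff)
  then have "M \<ge> 1" using n_pos assms(3) by (simp add: M_def)
  obtain k' where k': "k' < ?q ^ n" "\<And>x. x ^ k mod f = x ^ k' mod f"
    using power_mod_irreducible_reduce[of f k] basis assms(4) by (auto simp: ext_basis_def)
  \<comment> \<open>A crude comparison via q < 2^q: it yields q * n digits in base \<open>Q\<close>,
    which is linear in \<open>n\<close> for a fixed field, and hence at most \<open>M\<close>
    factors.\<close>
  have "?q \<le> Q ^ ?q"
    using less_exp[of ?q] power_mono[of 2 Q ?q] assms(3) by linarith
  then have "?q ^ n \<le> Q ^ (?q * n)"
    by (metis power_mono power_mult zero_le)
  with k'(1) have "k' < Q ^ (?q * n)" by simp
  then obtain es where es: "length es \<le> M" "k' = (\<Sum>e\<leftarrow>es. Q ^ e)"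
    using ex_sum_powers M_def by metis
  obtain t where t: "M \<le> 2 ^ t" "2 ^ t \<le> 2 * M"
    using ex_power_of_two_between[OF \<open>M \<ge> 1\<close>] by blast
  define Fs :: "('a list \<Rightarrow> 'a) list" where "Fs = map (\<lambda>j xs. xs ! j) [0..<n]"
  obtain T where T: "circuit n (0 + ?q * length Fs) (max 0 (Suc 0)) T"
      "\<And>F c. F \<in> set Fs \<Longrightarrow> (\<lambda>xs. c * F xs, Suc 0) \<in> free n T"
    by (rule circuit_scalings[OF circuit_empty, of Fs 0 n]) (auto simp: Fs_def intro: free.input)
  \<comment> \<open>The single layer of scaled input coordinates serves all Frobenius powers at
    once, since each of them is linear in the input.\<close>
  have frob: "res_avail n T (\<lambda>xs. elem \<beta> n xs ^ (Q ^ e)) 1" for e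
    unfolding res_avail_def
  proof (intro allI impI)
    fix j assume "j < n"
    have "(\<lambda>xs. \<Sum>i<n. coords \<beta> n (\<beta> i ^ (Q ^ e) mod f) ! j * xs ! i, Suc 0) \<in> free n T"
      by (intro free_sum T(2)) (simp add: Fs_def)
    moreover have "coords \<beta> n (elem \<beta> n xs ^ (Q ^ e) mod f) ! j =
        (\<Sum>i<n. coords \<beta> n (\<beta> i ^ (Q ^ e) mod f) ! j * xs ! i)" for xs
      by (simp add: elem_def frobenius_power_smult_sum[OF assms(1,2)]
          coords_mod_lincomb[OF basis \<open>j < n\<close>] mult.commute)
    ultimately show "(\<lambda>xs. coords \<beta> n (elem \<beta> n xs ^ (Q ^ e) mod f) ! j, 1) \<in> free n T"
      by simp
  qed
  \<comment> \<open>Leaves beyond the actual factors are filled with the constant 1.\<close>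
  define g where "g i xs = (if i < length es then elem \<beta> n xs ^ (Q ^ (es ! i)) else 1)" for i xs
  have "res_avail n T (g i) 1" for i
    unfolding g_def using frob by (cases "i < length es") (simp_all add: res_avail_def free.const)
  then obtain T' where T': "circuit n (0 + ?q * length Fs + (2 ^ t - 1) * cost) (max (max 0 (Suc 0)) (1 + 3 * t)) T'"
      "res_avail n T' (\<lambda>xs. \<Prod>i<2 ^ t. g i xs) (1 + 3 * t)"
    using circuit_prod[OF T(1), of t g 1] by blast
  have prod: "(\<Prod>i<2 ^ t. g i xs) = elem \<beta> n xs ^ k'" for xs
  proof -
    have "(\<Prod>i<2 ^ t. g i xs) = (\<Prod>i<length es. elem \<beta> n xs ^ (Q ^ (es ! i)))"
      using es(1) t(1) by (intro prod.mono_neutral_cong_right) (auto simp: g_def)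
    also have "\<dots> = elem \<beta> n xs ^ (\<Sum>i<length es. Q ^ (es ! i))"
      by (simp add: power_sum)
    also have "(\<Sum>i<length es. Q ^ (es ! i)) = k'"
      by (simp add: es(2) sum_list_sum_nth atLeast0LessThan)
    finally show ?thesis .
  qed
  have circ: "circuit n (?q * n + 2 * M * cost) (1 + 3 * t) T'"
    by (rule circuit_mono[OF T'(1)]) (use t(2) in \<open>auto simp: Fs_def intro: mult_le_mono1\<close>)
  define Gs where "Gs = map (\<lambda>j xs. coords \<beta> n (elem \<beta> n xs ^ k' mod f) ! j) [0..<n]"
  have "fpow f \<beta> n k xs = map (\<lambda>G. G xs) Gs" for xs
    using map_nth[of "coords \<beta> n (elem \<beta> n xs ^ k' mod f)"]
    by (simp add: Gs_def fpow_def k'(2) comp_def length_coords_mod)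
  moreover have "(G, 1 + 3 * t) \<in> free n T'" if "G \<in> set Gs" for G
    using that T'(2) by (auto simp: Gs_def res_avail_def prod)
  ultimately have "\<exists>P outs. computes n P outs (fpow f \<beta> n k) \<and> mdepth P \<le> 1 + 3 * t \<and>
      mwidth P \<le> ?q * n + 2 * M * cost \<and> msize P \<le> ?q * n + 2 * M * cost"
    using circuit_computes[OF circ, of Gs "1 + 3 * t" "fpow f \<beta> n k"] by blast
  then show ?thesis using t(2) by blast
qed

end

section \<open>Asymptotics\<close>

theorem theorem1p2:
  fixes \<epsilon> :: real
    and fq :: "'a::{finite,field} itself"
  assumes eps: "\<epsilon> > 0"
    and MM: "\<exists>C::real. \<forall>N\<ge>1. \<exists>(P :: 'a instr list) outs.
               computes (2 * N * N) P outs (matmul N) \<and> real (msize P) \<le> C * real N powr (2 + \<epsilon>)"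
  shows "\<exists>(C::real) N0. \<forall>n\<ge>N0. \<forall>(f :: 'a poly) \<beta>. ext_basis f \<beta> n \<longrightarrow>
     (\<exists>(P :: 'a instr list) outs. computes (2 * n) P outs (fmul f \<beta> n) \<and>
        real (mdepth P) \<le> C \<and> real (mwidth P) \<le> C * real n ^ 2 \<and> real (msize P) \<le> C * real n ^ 2)
   \<and> (\<forall>m\<ge>n. \<exists>(P :: 'a instr list) outs. computes (2 * n * m) P outs (fmul_many f \<beta> n m) \<and>
        real (mdepth P) \<le> C \<and>
        real (mwidth P) \<le> C * real m * real n powr (1 + \<epsilon>) \<and>
        real (msize P) \<le> C * real m * real n powr (1 + \<epsilon>))
   \<and> (\<forall>k\<ge>1. \<exists>(P :: 'a instr list) outs. computes n P outs (fpow f \<beta> n k) \<and>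
        real (mdepth P) \<le> C * ln (real n) \<and>
        real (mwidth P) \<le> C * real n powr (2 + \<epsilon>) / ln (real n) powr (2 * \<epsilon>) \<and>
        real (msize P) \<le> C * real n powr (2 + \<epsilon>) * ln (real n) powr (1 - 2 * \<epsilon>))"
proof -
  obtain j where j: "j > 0" "\<forall>c::'a. c ^ (CHAR('a) ^ j) = c"
    using ex_frobenius_exponent by blast
  define Q where "Q = CHAR('a) ^ j"
  have Q: "Q > 1"
    unfolding Q_def by (rule one_less_power[OF prime_gt_1_nat[OF prime_CHAR_finite_field] j(1)])
  define q where "q = card (UNIV :: 'a set)"
  have q: "q > 0" by (simp add: q_def card_gt_0_iff)
  define q' Q' where "q' = real q" and "Q' = real Q"
  have pos: "q' > 0" "Q' > 0" using q Q by (simp_all add: q'_def Q'_def)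
  \<comment> \<open>This is \<open>cost\<close> with the rank bound inserted, as a real function of
    order x log x.\<close>
  define K where "K x = q' * (2 * x) + (1 + q') * (2 * x * Q' * log 2 (2 * x * Q'))" for x :: real
  have "eventually (\<lambda>n. K (real n) \<le> real n ^ 2) sequentially"
    unfolding K_def using pos by real_asymp
  moreover have "eventually (\<lambda>n. K (real n) \<le> real n powr (1 + \<epsilon>)) sequentially"
    unfolding K_def using pos eps by real_asymp
  \<comment> \<open>The left side has order n^2 log n; the positive \<open>\<epsilon>\<close>
    absorbs every fixed power of the logarithm, including those in the denominator.\<close>
  moreover have "eventually (\<lambda>n. q' * real n + 2 * (q' * real n * Q') * K (real n) \<le>
      real n powr (2 + \<epsilon>) / ln (real n) powr (2 * \<epsilon>)) sequentially"
    unfolding K_def using pos eps by real_asymp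
  moreover have "eventually (\<lambda>n. q' * real n + 2 * (q' * real n * Q') * K (real n) \<le>
      real n powr (2 + \<epsilon>) * ln (real n) powr (1 - 2 * \<epsilon>)) sequentially"
    unfolding K_def using pos eps by real_asymp
  \<comment> \<open>The tree height is at most twice the natural logarithm of its number of leaves,
    so the depth is 6 ln n plus a constant.\<close>
  moreover have "eventually (\<lambda>n. 1 + 3 * (2 * ln (2 * (q' * real n * Q'))) \<le> 7 * ln (real n)) sequentially"
    using pos by real_asymp
  moreover have "eventually (\<lambda>n::nat. n \<ge> 2) sequentially"
    by (rule eventually_ge_at_top)
  ultimately have "eventually (\<lambda>n. K (real n) \<le> real n ^ 2 \<and> K (real n) \<le> real n powr (1 + \<epsilon>) \<and>
      q' * real n + 2 * (q' * real n * Q') * K (real n) \<le> real n powr (2 + \<epsilon>) / ln (real n) powr (2 * \<epsilon>) \<and>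
      q' * real n + 2 * (q' * real n * Q') * K (real n) \<le> real n powr (2 + \<epsilon>) * ln (real n) powr (1 - 2 * \<epsilon>) \<and>
      1 + 3 * (2 * ln (2 * (q' * real n * Q'))) \<le> 7 * ln (real n) \<and> n \<ge> 2) sequentially"
    by eventually_elim simp
  then obtain N0 where N0: "\<And>n. n \<ge> N0 \<Longrightarrow> K (real n) \<le> real n ^ 2 \<and> K (real n) \<le> real n powr (1 + \<epsilon>) \<and>
      q' * real n + 2 * (q' * real n * Q') * K (real n) \<le> real n powr (2 + \<epsilon>) / ln (real n) powr (2 * \<epsilon>) \<and>
      q' * real n + 2 * (q' * real n * Q') * K (real n) \<le> real n powr (2 + \<epsilon>) * ln (real n) powr (1 - 2 * \<epsilon>) \<and>
      1 + 3 * (2 * ln (2 * (q' * real n * Q'))) \<le> 7 * ln (real n) \<and> n \<ge> 2"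
    unfolding eventually_sequentially by blast
  show ?thesis
  \<comment> \<open>The constant 7 is dictated by the depth of exponentiation; the size bounds hold
    with constant 1 and the depth of a product is 3.\<close>
  proof (intro exI[of _ "7 :: real"] exI[of _ N0] allI impI)
    fix n and f :: "'a poly" and \<beta> assume n: "n \<ge> N0" and basis: "ext_basis f \<beta> n"
    note bounds = N0[OF n]
    have "n > 0" using bounds by simp
    then obtain ts :: "(('a poly \<Rightarrow> 'a) \<times> ('a poly \<Rightarrow> 'a) \<times> 'a poly) list" where ts:
      "\<forall>(a, b, c)\<in>set ts. linear_form a \<and> linear_form b"
      "\<And>x y. degree x < n \<Longrightarrow> degree y < n \<Longrightarrow> x * y = bilin_sum ts x y"
      "real (length ts) \<le> 2 * real n * real Q * log 2 (2 * real n * real Q)"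
      using ex_bilin_mult_quasilinear[OF j(2)[folded Q_def] Q_def j(1)] by blast
    interpret field_mult f \<beta> n ts
      using basis ts(1,2) by unfold_locales
    have "real cost = q' * (2 * real n) + (1 + q') * real (length ts)"
      by (simp add: cost_def q_def q'_def algebra_simps)
    also have "\<dots> \<le> K (real n)"
      unfolding K_def using ts(3) pos by (intro add_left_mono mult_left_mono) (simp_all add: Q'_def)
    finally have cost: "real cost \<le> K (real n)" .
    have a: "\<exists>(P :: 'a instr list) outs. computes (2 * n) P outs (fmul f \<beta> n) \<and> real (mdepth P) \<le> 7 \<and>
        real (mwidth P) \<le> 7 * real n ^ 2 \<and> real (msize P) \<le> 7 * real n ^ 2"
    proof -
      obtain P outs where P: "computes (2 * n) P outs (fmul f \<beta> n)" "mdepth P \<le> 3"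
          "mwidth P \<le> cost" "msize P \<le> cost"
        using fmul_computes by blast
      have "real cost \<le> 7 * real n ^ 2"
        using cost bounds zero_le_power2[of "real n"] by linarith
      then show ?thesis
        using P by (intro exI[of _ P] exI[of _ outs]) auto
    qed
    have b: "\<exists>(P :: 'a instr list) outs. computes (2 * n * m) P outs (fmul_many f \<beta> n m) \<and> real (mdepth P) \<le> 7 \<and>
        real (mwidth P) \<le> 7 * real m * real n powr (1 + \<epsilon>) \<and>
        real (msize P) \<le> 7 * real m * real n powr (1 + \<epsilon>)" for m
    proof -
      obtain P outs where P: "computes (2 * n * m) P outs (fmul_many f \<beta> n m)" "mdepth P \<le> 3"
          "mwidth P \<le> m * cost" "msize P \<le> m * cost"
        using fmul_many_computes by blast
      have cost_m: "real (m * cost) \<le> real m * (7 * real n powr (1 + \<epsilon>))"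
        unfolding of_nat_mult using cost bounds powr_ge_zero[of "real n" "1 + \<epsilon>"]
        by (intro mult_left_mono) (linarith, simp)
      have "real (mwidth P) \<le> 7 * real m * real n powr (1 + \<epsilon>)"
        "real (msize P) \<le> 7 * real m * real n powr (1 + \<epsilon>)"
        using P(3,4)[folded of_nat_le_iff[where 'a = real]] cost_m by linarith+
      then show ?thesis
        using P(1,2) by (intro exI[of _ P] exI[of _ outs]) simp
    qed
    have c: "\<exists>(P :: 'a instr list) outs. computes n P outs (fpow f \<beta> n k) \<and> real (mdepth P) \<le> 7 * ln (real n) \<and>
        real (mwidth P) \<le> 7 * real n powr (2 + \<epsilon>) / ln (real n) powr (2 * \<epsilon>) \<and>
        real (msize P) \<le> 7 * real n powr (2 + \<epsilon>) * ln (real n) powr (1 - 2 * \<epsilon>)" if "k \<ge> 1" for k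
    proof -
      define S where "S = q * n + 2 * (q * n * Q) * cost"
      obtain P outs t where P: "computes n P outs (fpow f \<beta> n k)" "2 ^ t \<le> 2 * (q * n * Q)"
          "mdepth P \<le> 1 + 3 * t" "mwidth P \<le> S" "msize P \<le> S"
        using fpow_computes[OF j(2)[folded Q_def] Q_def Q \<open>k \<ge> 1\<close>] unfolding S_def q_def by blast
      have "real (2 ^ t) \<le> real (2 * (q * n * Q))"
        using P(2) by (simp only: of_nat_le_iff)
      then have "ln (2 ^ t) \<le> ln (2 * (q' * real n * Q'))"
        by (intro ln_mono) (simp_all add: q'_def Q'_def)
      moreover have "real t * (1 / 2) \<le> real t * ln 2"
        using ln_le_minus_one[of "1 / 2 :: real"] by (intro mult_left_mono) (simp_all add: ln_div)
      ultimately have "real t \<le> 2 * ln (2 * (q' * real n * Q'))"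
        by (simp add: ln_realpow)
      then have "real (mdepth P) \<le> 1 + 3 * (2 * ln (2 * (q' * real n * Q')))"
        using P(3) by linarith
      then have depth: "real (mdepth P) \<le> 7 * ln (real n)"
        using bounds by linarith
      have "real S = q' * real n + 2 * (q' * real n * Q') * real cost"
        by (simp add: S_def q'_def Q'_def)
      also have "\<dots> \<le> q' * real n + 2 * (q' * real n * Q') * K (real n)"
        using cost pos by (intro add_left_mono mult_left_mono) simp_all
      finally have S: "real S \<le> real n powr (2 + \<epsilon>) / ln (real n) powr (2 * \<epsilon>)"
          "real S \<le> real n powr (2 + \<epsilon>) * ln (real n) powr (1 - 2 * \<epsilon>)"
        using bounds by linarith+
      have nonneg: "0 \<le> real n powr (2 + \<epsilon>) / ln (real n) powr (2 * \<epsilon>)"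
          "0 \<le> real n powr (2 + \<epsilon>) * ln (real n) powr (1 - 2 * \<epsilon>)"
        by simp_all
      have "real (mwidth P) \<le> 7 * (real n powr (2 + \<epsilon>) / ln (real n) powr (2 * \<epsilon>))"
        "real (msize P) \<le> 7 * (real n powr (2 + \<epsilon>) * ln (real n) powr (1 - 2 * \<epsilon>))"
        using P(4,5) S nonneg by linarith+
      then show ?thesis
        using P(1) depth by (intro exI[of _ P] exI[of _ outs]) simp
    qed
    show "(\<exists>(P :: 'a instr list) outs. computes (2 * n) P outs (fmul f \<beta> n) \<and>
        real (mdepth P) \<le> 7 \<and> real (mwidth P) \<le> 7 * real n ^ 2 \<and> real (msize P) \<le> 7 * real n ^ 2)
      \<and> (\<forall>m\<ge>n. \<exists>(P :: 'a instr list) outs. computes (2 * n * m) P outs (fmul_many f \<beta> n m) \<and>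
        real (mdepth P) \<le> 7 \<and>
        real (mwidth P) \<le> 7 * real m * real n powr (1 + \<epsilon>) \<and>
        real (msize P) \<le> 7 * real m * real n powr (1 + \<epsilon>))
      \<and> (\<forall>k\<ge>1. \<exists>(P :: 'a instr list) outs. computes n P outs (fpow f \<beta> n k) \<and>
        real (mdepth P) \<le> 7 * ln (real n) \<and>
        real (mwidth P) \<le> 7 * real n powr (2 + \<epsilon>) / ln (real n) powr (2 * \<epsilon>) \<and>
        real (msize P) \<le> 7 * real n powr (2 + \<epsilon>) * ln (real n) powr (1 - 2 * \<epsilon>))"
      using a b c by blast
  qed
qed

end
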